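(* Let $n\in\mathbb N_0$ and $b,c,d,e,f,q\in\mathbb C^*$ with $|q|\ne1$. Then the terminating series $${}_8W_7\left(b;q^{-n},c,d,e,f;q,\frac{q^{n+2}b^2}{cdef}\right)$$ is equal to each of the following expressions (whenever no denominator occurring vanishes): (1) $\displaystyle q^{\binom n2}\left(\frac{-q^2b^2}{cdef}\right)^n\frac{(qb,b,c,d,e,f;q)_n}{(b;q)_{2n}\left(\frac{qb}c,\frac{qb}d,\frac{qb}e,\frac{qb}f;q\right)_n}\,{}_8W_7\left(\frac{q^{-2n}}b;q^{-n},\frac{q^{-n}c}b,\frac{q^{-n}d}b,\frac{q^{-n}e}b,\frac{q^{-n}f}b;q,\frac{q^{n+2}b^2}{cdef}\right)$; (2) $\displaystyle\frac{\left(\frac{qb}{ce},\frac{qb}{cf},qb,d;q\right)_n}{\left(\frac{qb}c,\frac{qb}e,\frac{qb}f,\frac dc;q\right)_n}\,{}_8W_7\left(\frac{q^{-n}c}d;q^{-n},\frac{q^{-n}c}b,\frac{qb}{de},\frac{qb}{df},c;q,\frac{ef}b\right)$; (3) $\displaystyle\frac{\left(\frac{qb}{de},\frac{qb}{df},\frac{qb}{ef},qb;q\right)_n}{\left(\frac{qb}{def},\frac{qb}d,\frac{qb}e,\frac{qb}f;q\right)_n}\,{}_8W_7\left(\frac{q^{-n-1}def}b;q^{-n},d,e,f,\frac{q^{-n-1}cdef}{b^2};q,\frac qc\right)$; (4) $\displaystyle\frac{\left(\frac{q^2b^2}{cdef},qb,d,e,f;q\right)_n}{\left(\frac{def}{qb},\frac{qb}c,\frac{qb}d,\frac{qb}e,\frac{qb}f;q\right)_n}\,{}_8W_7\left(\frac{q^{1-n}b}{def};q^{-n},\frac{q^{-n}c}b,\frac{qb}{de},\frac{qb}{df},\frac{qb}{ef};q,\frac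 qc\right)$; (5) $\displaystyle\frac{\left(\frac{q^2b^2}{cdef},qb;q\right)_n}{\left(\frac{qb}c,\frac{q^2b^2}{def};q\right)_n}\,{}_8W_7\left(\frac{qb^2}{def};q^{-n},\frac{qb}{de},\frac{qb}{df},\frac{qb}{ef},c;q,\frac{q^{n+1}b}c\right)$; (6) $\displaystyle q^{\binom n2}\left(-\frac{qb}c\right)^n\frac{\left(\frac{qb^2}{def},\frac{qb}{ef},\frac{qb}{de},\frac{qb}{df},qb,c;q\right)_n}{\left(\frac{qb^2}{def};q\right)_{2n}\left(\frac{qb}c,\frac{qb}d,\frac{qb}e,\frac{qb}f;q\right)_n}\,{}_8W_7\left(\frac{q^{-2n-1}def}{b^2};q^{-n},\frac{q^{-n}d}b,\frac{q^{-n}e}b,\frac{q^{-n}f}b,\frac{q^{-n-1}cdef}{b^2};q,\frac{q^{n+1}b}c\right)$; (7) $\displaystyle\frac{\left(\frac{qb}{cd},qb;q\right)_n}{\left(\frac{qb}c,\frac{qb}d;q\right)_n}\,{}_4\phi_3\left(q^{-n},\frac{qb}{ef},c,d;\,\frac{q^{-n}cd}b,\frac{qb}e,\frac{qb}f;\,q,q\right)$; (8) $\displaystyle\left(\frac{qb}{ef}\right)^n\frac{\left(\frac{qb}{cd},qb,e,f;q\right)_n}{\left(\frac{qb}c,\frac{qb}d,\frac{qb}e,\frac{qb}f;q\right)_n}\,{}_4\phi_3\left(q^{-n},\frac{q^{-n}c}b,\frac{q^{-n}d}b,\frac{qb}{ef};\,\frac{q^{-n}cd}b,\frac{q^{1-n}}e,\frac{q^{1-n}}f;\,q,q\right)$;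 (9) $\displaystyle\frac{\left(\frac{q^2b^2}{cdef},qb,c;q\right)_n}{\left(\frac{qb}d,\frac{qb}e,\frac{qb}f;q\right)_n}\,{}_4\phi_3\left(q^{-n},\frac{qb}{cd},\frac{qb}{ce},\frac{qb}{cf};\,\frac{q^2b^2}{cdef},\frac{q^{1-n}}c,\frac{qb}c;\,q,q\right)$; (10) $\displaystyle c^n\frac{\left(\frac{qb}{cd},\frac{qb}{ce},\frac{qb}{cf},qb;q\right)_n}{\left(\frac{qb}c,\frac{qb}d,\frac{qb}e,\frac{qb}f;q\right)_n}\,{}_4\phi_3\left(q^{-n},\frac{q^{-n-1}cdef}{b^2},\frac{q^{-n}c}b,c;\,\frac{q^{-n}cd}b,\frac{q^{-n}ce}b,\frac{q^{-n}cf}b;\,q,q\right)$.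
   Context: $\mathbb N_0=\{0,1,2,\ldots\}$, $\mathbb C^*=\mathbb C\setminus\{0\}$; $e$ is a parameter, not Euler's number. The $q$-Pochhammer symbol is $(a;q)_n=(1-a)(1-aq)\cdots(1-aq^{n-1})$ (empty product equal to $1$), and $(a_1,\ldots,a_k;q)_n=(a_1;q)_n\cdots(a_k;q)_n$. The terminating series are $${}_4\phi_3(q^{-n},\alpha,\beta,\gamma;\,\delta,\epsilon,\zeta;\,q,z)=\sum_{k=0}^n\frac{(q^{-n},\alpha,\beta,\gamma;q)_k}{(q,\delta,\epsilon,\zeta;q)_k}z^k,$$ $${}_8W_7(b;q^{-n},c,d,e,f;q,z)=\sum_{k=0}^n\frac{\left(b,q\sqrt b,-q\sqrt b,q^{-n},c,d,e,f;q\right)_k}{\left(q,\sqrt b,-\sqrt b,q^{n+1}b,\frac{qb}c,\frac{qb}d,\frac{qb}e,\frac{qb}f;q\right)_k}z^k,$$ where $\sqrt b$ is either square root of $b$. Standing convention: denominator parameters of a terminating series avoid $\{q^{-k}:0\le k\le n-1\}$, so that no denominator vanishes. *)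

theory Defs
  imports Complex_Main
begin

definition qpoch :: "complex \<Rightarrow> complex \<Rightarrow> nat \<Rightarrow> complex" where
  "qpoch a q n = (\<Prod>k<n. 1 - a * q ^ k)"

definition qpochs :: "complex list \<Rightarrow> complex \<Rightarrow> nat \<Rightarrow> complex" where
  "qpochs as q n = (\<Prod>a\<leftarrow>as. qpoch a q n)"

(* The convention on denominator parameters of a terminating series. *)
definition avoids :: "complex list \<Rightarrow> complex \<Rightarrow> nat \<Rightarrow> bool" where
  "avoids as q n \<longleftrightarrow> (\<forall>a\<in>set as. \<forall>k<n. a \<noteq> q powi (- int k))"

(* In phi43 and W87 the argument n stands for the numerator parameter q^(-n). *)

definition phi43 ::
  "nat \<Rightarrow> complex \<Rightarrow> complex \<Rightarrow> complex \<Rightarrow> complex \<Rightarrow> complex \<Rightarrow> complex \<Rightarrow> complex \<Rightarrow> complex \<Rightarrow> complex"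
where
  "phi43 n \<alpha> \<beta> \<gamma> \<delta> \<epsilon> \<zeta> q z =
     (\<Sum>k\<le>n. qpochs [q powi (- int n), \<alpha>, \<beta>, \<gamma>] q k / qpochs [q, \<delta>, \<epsilon>, \<zeta>] q k * z ^ k)"

definition phi43_ok :: "nat \<Rightarrow> complex \<Rightarrow> complex \<Rightarrow> complex \<Rightarrow> complex \<Rightarrow> bool" where
  "phi43_ok n \<delta> \<epsilon> \<zeta> q \<longleftrightarrow> avoids [q, \<delta>, \<epsilon>, \<zeta>] q n"

(* W87_num and W87_den take a square root s of b; W87 and W87_ok use the principal one.
   W87_root and W87_ok_root below show that the choice of root is immaterial. *)

definition W87_num ::
  "complex \<Rightarrow> complex \<Rightarrow> nat \<Rightarrow> complex \<Rightarrow> complex \<Rightarrow> complex \<Rightarrow> complex \<Rightarrow> complex \<Rightarrow> complex list"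
where
  "W87_num s b n c d e f q = [b, q * s, - q * s, q powi (- int n), c, d, e, f]"

definition W87_den ::
  "complex \<Rightarrow> complex \<Rightarrow> nat \<Rightarrow> complex \<Rightarrow> complex \<Rightarrow> complex \<Rightarrow> complex \<Rightarrow> complex \<Rightarrow> complex list"
where
  "W87_den s b n c d e f q =
     [q, s, - s, q ^ (n + 1) * b, q * b / c, q * b / d, q * b / e, q * b / f]"

definition W87 ::
  "complex \<Rightarrow> nat \<Rightarrow> complex \<Rightarrow> complex \<Rightarrow> complex \<Rightarrow> complex \<Rightarrow> complex \<Rightarrow> complex \<Rightarrow> complex"
where
  "W87 b n c d e f q z =
     (\<Sum>k\<le>n. qpochs (W87_num (csqrt b) b n c d e f q) q k
              / qpochs (W87_den (csqrt b) b n c d e f q) q k * z ^ k)"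

definition W87_ok ::
  "complex \<Rightarrow> nat \<Rightarrow> complex \<Rightarrow> complex \<Rightarrow> complex \<Rightarrow> complex \<Rightarrow> complex \<Rightarrow> bool"
where
  "W87_ok b n c d e f q \<longleftrightarrow> avoids (W87_den (csqrt b) b n c d e f q) q n"

lemma W87_root:
  assumes "s\<^sup>2 = b"
  shows "W87 b n c d e f q z =
     (\<Sum>k\<le>n. qpochs (W87_num s b n c d e f q) q k / qpochs (W87_den s b n c d e f q) q k * z ^ k)"
proof -
  have "s = csqrt b \<or> s = - csqrt b"
    by (simp add: assms flip: power2_eq_iff)
  then show ?thesis
    by (auto simp: W87_def W87_num_def W87_den_def qpochs_def mult_ac)
qed

lemma W87_ok_root:
  assumes "s\<^sup>2 = b"
  shows "W87_ok b n c d e f q \<longleftrightarrow> avoids (W87_den s b n c d e f q) q n"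
proof -
  have "s = csqrt b \<or> s = - csqrt b"
    by (simp add: assms flip: power2_eq_iff)
  then show ?thesis
    by (auto simp: W87_ok_def W87_den_def avoids_def)
qed

lemma avoids_iff_qpochs_nonzero:
  assumes "q \<noteq> 0"
  shows "avoids as q n \<longleftrightarrow> (\<forall>k\<le>n. qpochs as q k \<noteq> 0)"
proof -
  have eq: "a * q ^ k = 1 \<longleftrightarrow> a = q powi (- int k)" for a k
    using assms by (simp add: power_int_minus field_simps)
  have z: "qpochs as q m = 0 \<longleftrightarrow> (\<exists>a\<in>set as. \<exists>k<m. a = q powi (- int k))" for m
  proof -
    have "qpochs as q m = 0 \<longleftrightarrow> (\<exists>a\<in>set as. qpoch a q m = 0)"
      by (induction as) (auto simp: qpochs_def)
    also have "\<dots> \<longleftrightarrow> (\<exists>a\<in>set as. \<exists>k<m. a * q ^ k = 1)"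
      unfolding qpoch_def by (auto simp: eq_commute[of 1])
    finally show ?thesis by (simp only: eq)
  qed
  show ?thesis
    unfolding avoids_def z by (meson order.refl order.strict_trans2)
qed

end

theory Submission
  imports Defs
begin

text \<open>
  All eleven expressions describe one function of the parameters. Put \<open>x = qb/(cd)\<close> and let
  \<open>Om(c,d,e,f)\<close> be the terminating balanced \<open>4\<phi>3\<close> with numerator parameters \<open>qb/(ef), c, d\<close> and
  denominator parameters \<open>q/(q^n x), qb/e, qb/f\<close>, multiplied by the \<open>q\<close>-Pochhammer symbols of
  its denominator parameters and by \<open>q^(n choose 2) (-x)^n\<close>. Watson's transformation (\<open>watson\<close>)
  says that the very-well-poised series \<open>W\<close> satisfies
  \<open>W (qb/c, qb/d, qb/e, qb/f; q)_n = (qb; q)_n Om(c,d,e,f)\<close>. It follows by expanding the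
  \<open>e,f\<close>-part of every term of \<open>W\<close> by the \<open>q\<close>-Saalschuetz sum (\<open>saalschuetz\<close>), interchanging the
  two summations and evaluating the inner one by the \<open>6W5\<close> sum (\<open>sum_6W5\<close>).

  The left side is symmetric in \<open>c,d,e,f\<close>, hence so is \<open>Om\<close> (\<open>Om_swap\<close>). Written in the
  parameters of the \<open>4\<phi>3\<close>, this symmetry is Sears' transformation (\<open>sears\<close>). Because \<open>Om\<close> is a
  Laurent polynomial in \<open>b\<close>, symmetry for all but finitely many \<open>b\<close> implies symmetry for all of
  them, and Sears' transformation holds for the series multiplied by its denominators without
  any restriction on the denominator parameters.

  Each of the four \<open>4\<phi>3\<close> expressions is then \<open>Om\<close>, rewritten by at most one application of
  Sears' transformation. For each of the six \<open>8W7\<close> expressions, Watson's transformation of that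
  series leads to a \<open>4\<phi>3\<close> which is again one of these forms of \<open>Om\<close>, up to a permutation of
  \<open>c,d,e,f\<close>. The prefactors come from reading products backwards, \<open>(q/(q^n x); q)_n\<close> being a
  monomial times \<open>(x; q)_n\<close> (\<open>P_reflect\<close>). Outside the continuity arguments no step divides by a
  quantity that could vanish under the hypotheses of the individual expression, so the
  exceptional parameter values need no separate treatment.
\<close>

section \<open>Finite q-Pochhammer symbols and auxiliary facts\<close>

lemma qpoch_0 [simp]: "qpoch a q 0 = 1" by (simp add: qpoch_def)

lemma qpoch_Suc: "qpoch a q (Suc n) = qpoch a q n * (1 - a * q ^ n)" by (simp add: qpoch_def)

lemma qpoch_Suc_left: "qpoch a q (Suc n) = (1 - a) * qpoch (a * q) q n"
  unfolding qpoch_def by (subst prod.lessThan_Suc_shift) (simp add: mult_ac)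

lemma qpoch_add: "qpoch a q (m + n) = qpoch a q m * qpoch (a * q ^ m) q n"
  by (induction n) (simp_all add: qpoch_Suc power_add mult_ac)

lemma qpoch_eq_0_iff: "qpoch a q n = 0 \<longleftrightarrow> (\<exists>k<n. a * q ^ k = 1)"
  unfolding qpoch_def by (auto simp: eq_commute[of 1])

lemma qpoch_split: "j \<le> n \<Longrightarrow> qpoch a q n = qpoch a q j * qpoch (a * q ^ j) q (n - j)"
  using qpoch_add[of a q j "n - j"] by simp

lemma qpoch_nz_mono: "qpoch a q n \<noteq> 0 \<Longrightarrow> j \<le> n \<Longrightarrow> qpoch a q j \<noteq> 0"
  by (auto simp: qpoch_eq_0_iff)

lemma continuous_qpoch [continuous_intros]:
  "continuous F f \<Longrightarrow> continuous F (\<lambda>x. qpoch (f x) q n)"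
  unfolding qpoch_def by (intro continuous_intros)

text \<open>
  This extends identities from generic parameters to all parameters at which both sides are
  continuous.
\<close>
lemma continuous_eq_off_finite:
  fixes f g :: "complex \<Rightarrow> complex"
  assumes "isCont f x" "isCont g x" "finite A" "\<And>t. t \<notin> A \<Longrightarrow> f t = g t"
  shows "f x = g x"
proof -
  have ev: "eventually (\<lambda>t. f t = g t) (at x)"
  proof -
    have "open (- (A - {x}))" by (intro open_Compl finite_imp_closed) (simp add: assms(3))
    then have "eventually (\<lambda>t. t \<in> - (A - {x})) (at x)"
      by (intro eventually_at_in_open') auto
    moreover have "eventually (\<lambda>t. t \<noteq> x) (at x)" by (simp add: eventually_at_filter)
    ultimately show ?thesis by eventually_elim (use assms(4) in auto)
  qed
  have "(g \<longlongrightarrow> f x) (at x)"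
    using assms(1) ev unfolding isCont_def by (rule Lim_transform_eventually)
  then show ?thesis using assms(2) unfolding isCont_def by (metis LIM_unique)
qed

lemma sum_triangle_shift:
  fixes a :: "nat \<Rightarrow> nat \<Rightarrow> complex"
  shows "(\<Sum>k\<le>n. \<Sum>j\<le>k. a k j) = (\<Sum>j\<le>n. \<Sum>m\<le>n-j. a (j+m) j)"
proof -
  have "(\<Sum>j\<le>n. \<Sum>m\<le>n-j. a (j+m) j) = (\<Sum>(j,m)\<in>(SIGMA j:{..n}. {..n-j}). a (j+m) j)"
    by (simp add: sum.Sigma)
  also have "(SIGMA j:{..n}. {..n-j}) = {(j,m). j + m \<le> n}" by auto
  also have "(\<Sum>(j,m)\<in>\<dots>. a (j+m) j) = (\<Sum>k\<le>n. \<Sum>j\<le>k. a (j+(k-j)) j)"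
    by (rule sum.triangle_reindex_eq)
  finally show ?thesis by simp
qed

section \<open>Two summation formulas\<close>

text \<open>
  The second assumption keeps \<open>(q;q)_k\<close>, which occurs in the denominator of every series, from
  vanishing.
\<close>
locale q_base =
  fixes q :: complex
  assumes q_nz: "q \<noteq> 0" and q_pow: "0 < k \<Longrightarrow> q ^ k \<noteq> 1"
begin

abbreviation P :: "complex \<Rightarrow> nat \<Rightarrow> complex" where "P a k \<equiv> qpoch a q k"

lemma P_q_nz [simp]: "P q k \<noteq> 0"
  using q_pow[of "Suc _"] by (auto simp: qpoch_eq_0_iff)

lemma finite_geom: "x \<noteq> 0 \<Longrightarrow> finite {t. \<exists>j\<le>K::nat. t * x * q ^ j = 1}"
proof -
  assume "x \<noteq> 0"
  then have "{t. \<exists>j\<le>K. t * x * q ^ j = 1} \<subseteq> (\<lambda>j. 1 / (x * q ^ j)) ` {..K}"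
    using q_nz by (auto simp: field_simps image_iff)
  then show ?thesis using finite_surj by blast
qed

text \<open>
  The \<open>q\<close>-Saalschuetz sum, in the parametrisation whose right side is the \<open>e,f\<close>-part of a term
  of the \<open>8W7\<close>. Only \<open>(q^(-k), b q^k; q)_j\<close> depends on \<open>k\<close>, and its increment from \<open>k\<close> to \<open>k+1\<close>
  contains the factor \<open>1 - q^j\<close>. Cancelling it against \<open>(q;q)_j\<close> and shifting \<open>j\<close> turns the
  increment of the sum into a multiple of the same sum with \<open>b q\<close> in place of \<open>b\<close> and the same
  \<open>e, f\<close>, which explains the induction with \<open>b\<close> arbitrary.
\<close>
lemma saalschuetz:
  assumes "b \<noteq> 0" "e \<noteq> 0" "f \<noteq> 0" "P (q*b/e) k \<noteq> 0" "P (q*b/f) k \<noteq> 0"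
  shows "(\<Sum>j\<le>k. P (1/q^k) j * P (b*q^k) j * P (q*b/(e*f)) j
             / (P q j * P (q*b/e) j * P (q*b/f) j) * q^j)
       = P e k * P f k * (q*b/(e*f))^k / (P (q*b/e) k * P (q*b/f) k)"
  using assms
proof (induction k arbitrary: b)
  case 0 then show ?case by simp
next
  case (Suc k)
  define g E F where g: "g = q*b/(e*f)" and E: "E = q*b/e" and F: "F = q*b/f"
  note nz = Suc.prems(1-3) q_nz
  have E0: "1 - E \<noteq> 0" "1 - F \<noteq> 0" "P (E*q) k \<noteq> 0" "P (F*q) k \<noteq> 0" "P E k \<noteq> 0" "P F k \<noteq> 0"
      "1 - E*q^k \<noteq> 0" "1 - F*q^k \<noteq> 0"
    using Suc.prems(4,5) qpoch_Suc_left[of E q k] qpoch_Suc[of E q k]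
      qpoch_Suc_left[of F q k] qpoch_Suc[of F q k] unfolding E[symmetric] F[symmetric] by auto
  define S where "S = (\<lambda>k. \<Sum>j\<le>k. P (1/q^k) j * P (b*q^k) j * P g j / (P q j * P E j * P F j) * q^j)"
  define S' where "S' = (\<Sum>j\<le>k. P (1/q^k) j * P ((b*q)*q^k) j * P (g*q) j / (P q j * P (E*q) j
      * P (F*q) j) * q^j)"
  have IH1: "S k = P e k * P f k * g^k / (P E k * P F k)"
    unfolding S_def g E F by (rule Suc.IH) (use Suc.prems E0 E F in auto)
  have IH2: "S' = P e k * P f k * (g*q)^k / (P (E*q) k * P (F*q) k)"
    using Suc.IH[of "b*q"] nz E0 unfolding S'_def g E F by (simp add: mult_ac)
  have diff: "P (1/q^Suc k) (Suc i) * P (b*q^Suc k) (Suc i) - P (1/q^k) (Suc i) * P (b*q^k) (Suc i)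
      = - (1 - q^Suc i) / q^Suc k * (1 - b*q^(2*k+1)) * (P (1/q^k) i * P ((b*q)*q^k) i)" for i
  proof -
    have 1: "P (1/q^Suc k) (Suc i) = (1 - 1/q^Suc k) * P (1/q^k) i"
      using q_nz by (simp add: qpoch_Suc_left)
    have 2: "P (b*q^k) (Suc i) = (1 - b*q^k) * P ((b*q)*q^k) i" by (simp add: qpoch_Suc_left mult_ac)
    have 3: "P (b*q^Suc k) (Suc i) = P ((b*q)*q^k) i * (1 - b*q^Suc k*q^i)" by (simp add: qpoch_Suc mult_ac)
    have 4: "P (1/q^k) (Suc i) = P (1/q^k) i * (1 - 1/q^k*q^i)" by (simp add: qpoch_Suc)
    have "(1 - 1/q^Suc k) * (1 - b*q^Suc k*q^i) - (1 - 1/q^k*q^i) * (1 - b*q^k)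
        = - (1 - q^Suc i) / q^Suc k * (1 - b*q^(2*k+1))"
    proof -
      have e: "q^Suc k = q^k*q" "q^(2*k+1) = q^k*q^k*q"
          "q^Suc i = q^i*q" by (simp_all add: power_add mult_2)
      have "q^k \<noteq> 0" using q_nz by simp
      with q_nz show ?thesis unfolding e by (simp add: divide_simps) (simp add: algebra_simps)
    qed
    note br = this
    have fac: "(x * p) * (r * y) - (p * z) * (w * r) = (x * y - z * w) * (p * r)" for x y z w p r :: complex
      by (simp add: algebra_simps)
    show ?thesis unfolding 1 2 3 4 fac br ..
  qed
  define K where "K = (1 - b*q^(2*k+1)) * (1-g) / (q^k * (1-E) * (1-F))"
  have "S (Suc k) - S k = S (Suc k) - (\<Sum>j\<le>Suc k. P (1/q^k) j * P (b*q^k) j * P g j / (P q j * P E j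
      * P F j) * q^j)"
    using q_nz by (simp add: S_def qpoch_Suc)
  also have "\<dots> = (\<Sum>j\<le>Suc k. (P (1/q^Suc k) j * P (b*q^Suc k) j - P (1/q^k) j * P (b*q^k) j)
      * (P g j / (P q j * P E j * P F j) * q^j))"
    unfolding S_def sum_subtractf[symmetric]
        by (intro sum.cong refl) (simp add: algebra_simps diff_divide_distrib)
  also have "\<dots> = (\<Sum>i\<le>k. - (1 - q^Suc i) / q^Suc k * (1 - b*q^(2*k+1)) * (P (1/q^k) i * P ((b*q)*q^k) i)
      * (P g (Suc i) / (P q (Suc i) * P E (Suc i) * P F (Suc i)) * q^Suc i))"
    by (simp only: sum.atMost_Suc_shift diff) simp
  also have "\<dots> = - K * S'"
    unfolding S'_def sum_distrib_left
  proof (intro sum.cong refl)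
    fix i
    have "P q (Suc i) = P q i * (1 - q^Suc i)" "1 - q^Suc i \<noteq> 0"
      using q_pow[of "Suc i"] by (simp_all add: qpoch_Suc)
    then show "- (1 - q^Suc i) / q^Suc k * (1 - b*q^(2*k+1)) * (P (1/q^k) i * P ((b*q)*q^k) i)
        * (P g (Suc i) / (P q (Suc i) * P E (Suc i) * P F (Suc i)) * q^Suc i)
      = - K * (P (1/q^k) i * P ((b*q)*q^k) i * P (g*q) i / (P q i * P (E*q) i * P (F*q) i) * q^i)"
      using q_nz unfolding K_def by (simp only: qpoch_Suc_left[of g] qpoch_Suc_left[of E]
          qpoch_Suc_left[of F]) (simp add: divide_simps, simp add: algebra_simps)
  qed
  finally have rec: "S (Suc k) = S k - K * S'"
    by (simp add: diff_eq_eq)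
  have PE: "P (E*q) k = P E k * (1 - E*q^k) / (1-E)" "P (F*q) k = P F k * (1 - F*q^k) / (1-F)"
    using E0 qpoch_Suc[of E q k] qpoch_Suc_left[of E q k] qpoch_Suc[of F q k] qpoch_Suc_left[of F q k]
    by (simp_all add: field_simps)
  have key: "(1 - E*q^k)*(1 - F*q^k) - (1 - b*q^(2*k+1)) * (1-g) = (1-e*q^k)*(1-f*q^k)*g"
  proof -
    have e: "q^(2*k+1) = q^k*q^k*q" by (simp add: power_add mult_2)
    show ?thesis using nz unfolding E F g e by (simp add: divide_simps) (simp add: algebra_simps)
  qed
  have "S (Suc k) = P e k * P f k * g^k / (P E k * P F k)
          - (1 - b*q^(2*k+1)) * (1-g) * (P e k * P f k * g^k / (P E k * (1 - E*q^k) * (P F k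
              * (1 - F*q^k))))"
    unfolding rec IH1 IH2 PE K_def using E0 q_nz by (simp add: power_mult_distrib)
  also have "\<dots> = P e k * P f k * g^k * ((1 - E*q^k)*(1 - F*q^k) - (1 - b*q^(2*k+1)) * (1-g)) / (P E k
      * (1 - E*q^k) * (P F k * (1 - F*q^k)))"
    using E0 by (simp add: divide_simps) (simp add: algebra_simps)
  also have "\<dots> = P e (Suc k) * P f (Suc k) * g^Suc k / (P E (Suc k) * P F (Suc k))"
    unfolding key qpoch_Suc by (simp add: mult_ac)
  finally show ?case unfolding S_def g E F .
qed

text \<open>
  The sum of a terminating very-well-poised \<open>6W5\<close>, multiplied by \<open>1 - a\<close> so that \<open>a = 1\<close> makes
  sense. Only the factor called \<open>u\<close> in the proof depends on \<open>N\<close>, and its increment contains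
  \<open>(1 - q^m) (1 - a q^m)\<close>. After cancellation and the shift of \<open>m\<close>, the increment of the sum is
  a multiple of the same sum at \<open>a q^2, B q, C q\<close>. The recursion runs through the denominators
  of all shorter sums, hence the assumption on the whole of \<open>(a q; q)_(2N)\<close>.
\<close>
lemma sum_6W5_generic:
  assumes "a \<noteq> 0" "B \<noteq> 0" "C \<noteq> 0" "P (a*q/B) N \<noteq> 0" "P (a*q/C) N \<noteq> 0"
    and "P (a*q) (2*N) \<noteq> 0"
  shows "(\<Sum>m\<le>N. (1 - a*q^(2*m)) * P a m * P B m * P C m * P (1/q^N) m
             / (P q m * P (a*q/B) m * P (a*q/C) m * P (a*q^(N+1)) m) * (a*q^(N+1)/(B*C))^m)
       = (1-a) * P (a*q) N * P (a*q/(B*C)) N / (P (a*q/B) N * P (a*q/C) N)"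
  using assms
proof (induction N arbitrary: a B C)
  case 0 then show ?case by simp
next
  case (Suc N)
  define E F where E: "E = a*q/B" and F: "F = a*q/C"
  note nz = Suc.prems(1-3) q_nz
  have E0: "1 - E \<noteq> 0" "1 - F \<noteq> 0" "P (E*q) N \<noteq> 0" "P (F*q) N \<noteq> 0" "P E N \<noteq> 0" "P F N \<noteq> 0"
      "1 - E*q^N \<noteq> 0" "1 - F*q^N \<noteq> 0"
    using Suc.prems(4,5) qpoch_Suc_left[of E q N] qpoch_Suc[of E q N]
      qpoch_Suc_left[of F q N] qpoch_Suc[of F q N] unfolding E[symmetric] F[symmetric] by auto
  have ak: "a*q*q^k \<noteq> 1" if "k < 2*N+2" for k
    using Suc.prems(6) that unfolding qpoch_eq_0_iff by auto
  have a0: "P (a*q) (2*N) \<noteq> 0" "P ((a*q^2)*q) (2*N) \<noteq> 0"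
    unfolding qpoch_eq_0_iff using ak ak[of "_ + 2"] by (auto simp: power_add mult_ac power2_eq_square)
  have aN: "1 - a*q^(N+1) \<noteq> 0" "1 - a*q^(N+2) \<noteq> 0"
    using ak[of N] ak[of "N+1"] by (auto simp: mult_ac power_add)
  have aN3: "P (a*q^(N+3)) m \<noteq> 0" if "m \<le> N" for m
    unfolding qpoch_eq_0_iff using that ak[of "N+2+_"]
    by (auto simp: mult_ac power_add power2_eq_square numeral_3_eq_3)
  define V where "V = (\<lambda>m. (1 - a*q^(2*m)) * P a m * P B m * P C m / (P q m * P E m * P F m)
      * (a*q/(B*C))^m)"
  define S where "S = (\<lambda>N. \<Sum>m\<le>N. (1 - a*q^(2*m)) * P a m * P B m * P C m * P (1/q^N) m
             / (P q m * P E m * P F m * P (a*q^(N+1)) m) * (a*q^(N+1)/(B*C))^m)"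
  define a' where a': "a' = a*q^2"
  define S' where "S' = (\<Sum>m\<le>N. (1 - a'*q^(2*m)) * P a' m * P (B*q) m * P (C*q) m * P (1/q^N) m
             / (P q m * P (E*q) m * P (F*q) m * P (a'*q^(N+1)) m) * (a'*q^(N+1)/(B*q*(C*q)))^m)"
  define u where "u = (\<lambda>N m. P (1/q^N) m / P (a*q^(N+1)) m * q^(N*m))"
  have S: "S N = (\<Sum>m\<le>N. V m * u N m)" for N
    unfolding S_def V_def u_def
    unfolding power_mult[of q N] by (intro sum.cong refl) (simp add: power_mult_distrib power_divide
        power_add mult_ac)
  have IH1: "S N = (1-a) * P (a*q) N * P (a*q/(B*C)) N / (P E N * P F N)"
    unfolding S_def E F by (rule Suc.IH) (use Suc.prems E0 E F a0 in auto)
  have EF': "a'*q/(B*q) = E*q" "a'*q/(C*q) = F*q" "a'*q/(B*q*(C*q)) = a*q/(B*C)"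
    using nz unfolding a' E F by (auto simp: power2_eq_square)
  have IH2: "S' = (1-a') * P (a'*q) N * P (a*q/(B*C)) N / (P (E*q) N * P (F*q) N)"
    using Suc.IH[of a' "B*q" "C*q"] nz E0 a0 unfolding EF' unfolding S'_def a' by auto
  have diff: "u (Suc N) (Suc i) - u N (Suc i)
      = - (1 - q^Suc i) * (1 - a*q^Suc i) * (P (1/q^N) i * q^(N*Suc i) / ((1 - a*q^(N+1))
          * (1 - a*q^(N+2)) * P (a*q^(N+3)) i))" if "i \<le> N" for i
  proof -
    have n1: "P (a*q^(N+1)) (Suc (Suc i)) = (1 - a*q^(N+1)) * (1 - a*q^(N+2)) * P (a*q^(N+3)) i"
      by (simp add: qpoch_Suc_left mult_ac numeral_3_eq_3)
    have n2: "P (a*q^(N+1)) (Suc (Suc i)) = P (a*q^(N+1)) (Suc i) * (1 - a*q^(N+1)*q^Suc i)"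
      by (rule qpoch_Suc)
    have n3: "P (a*q^(N+1)) (Suc (Suc i)) = (1 - a*q^(N+1)) * P (a*q^(Suc N+1)) (Suc i)"
      by (subst qpoch_Suc_left) (simp add: mult_ac)
    define D where D: "D = P (a*q^(N+1)) (Suc (Suc i))"
    have D0: "D \<noteq> 0" unfolding D n1 using aN aN3[OF that] by simp
    have d1: "1 / P (a*q^(N+1)) (Suc i) = (1 - a*q^(N+1)*q^Suc i) / D"
      using D0 unfolding D n2 by auto
    have d2: "1 / P (a*q^(Suc N+1)) (Suc i) = (1 - a*q^(N+1)) / D"
      using D0 unfolding D n3 by auto
    have 1: "P (1/q^Suc N) (Suc i) = (1 - 1/q^Suc N) * P (1/q^N) i"
      using q_nz by (simp add: qpoch_Suc_left)
    have 4: "P (1/q^N) (Suc i) = P (1/q^N) i * (1 - 1/q^N*q^i)" by (simp add: qpoch_Suc)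
    have "u (Suc N) (Suc i) - u N (Suc i) = P (1/q^Suc N) (Suc i) * (1 / P (a*q^(Suc N+1)) (Suc i))
        * q^(Suc N*Suc i)
       - P (1/q^N) (Suc i) * (1 / P (a*q^(N+1)) (Suc i)) * q^(N*Suc i)" by (simp add: u_def add_ac)
    also have "\<dots> = P (1/q^N) i * q^(N*Suc i) / D * ((1 - 1/q^Suc N) * (1 - a*q^(N+1))
        * q^Suc i - (1 - 1/q^N*q^i) * (1 - a*q^(N+1)*q^Suc i))"
      unfolding d1 d2 1 4 by (simp add: power_add divide_simps) (simp add: algebra_simps)
    also have "(1 - 1/q^Suc N) * (1 - a*q^(N+1)) * q^Suc i - (1 - 1/q^N*q^i) * (1 - a*q^(N+1)*q^Suc i)
        = - (1 - q^Suc i) * (1 - a*q^Suc i)"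
      using q_nz by (simp add: field_simps)
    finally show ?thesis unfolding D n1 by simp
  qed
  define K where "K = (1-a)*(1-a*q)*(1-B)*(1-C)*(a*q^(N+1)/(B*C))
      / ((1-E)*(1-F)*(1-a*q^(N+1))*(1-a*q^(N+2)))"
  have "S (Suc N) - S N = S (Suc N) - (\<Sum>m\<le>Suc N. V m * u N m)"
    using q_nz by (simp add: S u_def qpoch_Suc)
  also have "\<dots> = (\<Sum>m\<le>Suc N. V m * (u (Suc N) m - u N m))"
    unfolding S sum_subtractf[symmetric] by (intro sum.cong refl) (simp add: algebra_simps)
  also have "\<dots> = (\<Sum>i\<le>N. V (Suc i) * (u (Suc N) (Suc i) - u N (Suc i)))"
    by (simp only: sum.atMost_Suc_shift) (simp add: u_def)
  also have "\<dots> = - K * S'"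
    unfolding S'_def sum_distrib_left
  proof (intro sum.cong refl)
    fix i assume "i \<in> {..N}"
    then have i: "i \<le> N" by simp
    have q1: "P q (Suc i) = P q i * (1 - q^Suc i)" "1 - q^Suc i \<noteq> 0"
      using q_pow[of "Suc i"] by (simp_all add: qpoch_Suc)
    have a1: "P a (Suc i) * (1 - a*q^Suc i) = (1-a) * (1-a*q) * P a' i"
      unfolding qpoch_Suc[symmetric] by (simp add: qpoch_Suc_left a' power2_eq_square mult_ac)
    have a2: "a'*q^(N+1) = a*q^(N+3)" by (simp add: a' power_add power2_eq_square numeral_3_eq_3)
    have a3: "a*q^(N+3)/(B*q*(C*q)) = a*q^(N+1)/(B*C)" using nz by (simp add: power_add numeral_3_eq_3)
    have a4: "1 - a*q^(2*Suc i) = 1 - a'*q^(2*i)" by (simp add: a' power2_eq_square)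
    have z: "(a*q/(B*C))^Suc i * q^(N*Suc i) = (a*q^(N+1)/(B*C)) * (a*q^(N+1)/(B*C))^i"
      by (simp add: power_mult_distrib power_divide power_add power_mult)
    have "V (Suc i) * (u (Suc N) (Suc i) - u N (Suc i))
      = - (1 - a*q^(2*Suc i)) * (P a (Suc i) * (1 - a*q^Suc i)) * P B (Suc i) * P C (Suc i)
          * P (1/q^N) i * ((a*q/(B*C))^Suc i * q^(N*Suc i))
        * ((1 - q^Suc i) / (P q (Suc i))) / (P E (Suc i) * P F (Suc i) * ((1 - a*q^(N+1))
            * (1 - a*q^(N+2)) * P (a*q^(N+3)) i))"
      unfolding diff[OF i] V_def by (simp only: mult_ac divide_inverse inverse_mult_distrib
          minus_mult_left[symmetric] minus_mult_right[symmetric])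
    also have "(1 - q^Suc i) / (P q (Suc i)) = 1 / P q i" using q1 by simp
    finally show "V (Suc i) * (u (Suc N) (Suc i) - u N (Suc i))
        = - K * ((1 - a'*q^(2*i)) * P a' i * P (B*q) i * P (C*q) i * P (1/q^N) i
             / (P q i * P (E*q) i * P (F*q) i * P (a'*q^(N+1)) i) * (a'*q^(N+1)/(B*q*(C*q)))^i)"
      unfolding a1 a2 a3 a4 z K_def qpoch_Suc_left[of B] qpoch_Suc_left[of C] qpoch_Suc_left[of E]
          qpoch_Suc_left[of F]
      by (simp only: mult_ac divide_inverse inverse_mult_distrib minus_mult_left[symmetric]
          minus_mult_right[symmetric] mult_1_left mult_1_right inverse_1)
  qed
  finally have rec: "S (Suc N) = S N - K * S'" by (simp add: algebra_simps)
  define R where "R = (1-a) * P (a*q) N * P (a*q/(B*C)) N / (P E N * (1 - E*q^N) * (P F N * (1 - F*q^N)))"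
  define x where x: "x = a*q^(N+1)"
  have EFx: "E*q^N = x/B" "F*q^N = x/C" "a*q/(B*C)*q^N = x/(B*C)"
      "a*q*q^N = x" by (simp_all add: E F x mult_ac)
  have PE: "P (E*q) N = P E N * (1 - E*q^N) / (1-E)" "P (F*q) N = P F N * (1 - F*q^N) / (1-F)"
    using E0 qpoch_Suc[of E q N] qpoch_Suc_left[of E q N] qpoch_Suc[of F q N] qpoch_Suc_left[of F q N]
    by (simp_all add: field_simps)
  have Pa: "(1-a*q)*(1-a')*P (a'*q) N = P (a*q) N * (1 - a*q^(N+1)) * (1 - a*q^(N+2))"
  proof -
    have "(1-a*q)*(1-a')*P (a'*q) N = P (a*q) (Suc (Suc N))"
      by (simp add: qpoch_Suc_left a' power2_eq_square mult_ac)
    also have "\<dots> = P (a*q) N * (1 - a*q^(N+1)) * (1 - a*q^(N+2))"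
      by (simp add: qpoch_Suc mult_ac)
    finally show ?thesis .
  qed
  have "K * S' = (1-a)*(1-B)*(1-C)*(a*q^(N+1)/(B*C)) * ((1-a*q)*(1-a')*P (a'*q) N)
      * P (a*q/(B*C)) N / ((1-a*q^(N+1))*(1-a*q^(N+2)) * (P E N * (1 - E*q^N) * (P F N * (1 - F*q^N))))"
    unfolding IH2 PE K_def using E0 by (simp add: mult_ac)
  also have "\<dots> = R * ((1-B)*(1-C)*(x/(B*C)))"
    unfolding Pa R_def x using aN by (simp add: mult_ac)
  finally have KS: "K * S' = R * ((1-B)*(1-C)*(x/(B*C)))" .
  have SR: "S N = R * ((1 - E*q^N) * (1 - F*q^N))" unfolding IH1 R_def using E0 by simp
  have key: "(1 - x/B) * (1 - x/C) - (1-B)*(1-C)*(x/(B*C)) = (1-x) * (1 - x/(B*C))"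
    using nz by (simp add: field_simps)
  have "S (Suc N) = R * ((1-x) * (1 - x/(B*C)))"
    unfolding rec SR KS EFx key[symmetric] by (simp add: algebra_simps)
  also have "\<dots> = (1-a) * P (a*q) (Suc N) * P (a*q/(B*C)) (Suc N) / (P E (Suc N) * P F (Suc N))"
    unfolding R_def qpoch_Suc EFx by simp
  finally show ?case unfolding S_def E F .
qed

text \<open>
  The same sum under the assumption that its own denominators do not vanish: after
  multiplication by \<open>(aq/B, aq/C; q)_N\<close> both sides are continuous at \<open>a\<close>, and only finitely many
  values of \<open>a\<close> are excluded from the generic case.
\<close>
lemma sum_6W5:
  assumes "a \<noteq> 0" "B \<noteq> 0" "C \<noteq> 0" "P (a*q/B) N \<noteq> 0" "P (a*q/C) N \<noteq> 0"
    and "P (a*q^(N+1)) N \<noteq> 0"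
  shows "(\<Sum>m\<le>N. (1 - a*q^(2*m)) * P a m * P B m * P C m * P (1/q^N) m
             / (P q m * P (a*q/B) m * P (a*q/C) m * P (a*q^(N+1)) m) * (a*q^(N+1)/(B*C))^m)
       = (1-a) * P (a*q) N * P (a*q/(B*C)) N / (P (a*q/B) N * P (a*q/C) N)"
proof -
  define s where "s = (\<lambda>a. \<Sum>m\<le>N. (1 - a*q^(2*m)) * P a m * P B m * P C m * P (1/q^N) m
             / (P q m * P (a*q/B) m * P (a*q/C) m * P (a*q^(N+1)) m) * (a*q^(N+1)/(B*C))^m)"
  define f where "f = (\<lambda>a. P (a*q/B) N * P (a*q/C) N * s a)"
  define g where "g = (\<lambda>a. (1-a) * P (a*q) N * P (a*q/(B*C)) N)"
  define A where "A = {0} \<union> {t. \<exists>j\<le>2*N. t * q * q ^ j = 1} \<union> {t. \<exists>j\<le>2*N. t * (q/B) * q ^ j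
      = 1} \<union> {t. \<exists>j\<le>2*N. t * (q/C) * q ^ j = 1}"
  have fin: "finite A" unfolding A_def using assms q_nz by (intro finite_UnI finite_geom) auto
  have eq: "f t = g t" if "t \<notin> A" for t
  proof -
    have "t \<noteq> 0" "P (t*q/B) N \<noteq> 0" "P (t*q/C) N \<noteq> 0" "P (t*q) (2*N) \<noteq> 0"
      using that unfolding A_def by (auto simp: qpoch_eq_0_iff)
    then show ?thesis unfolding f_def g_def s_def using sum_6W5_generic[of t B C N] assms by simp
  qed
  have contf: "isCont f a"
    unfolding f_def s_def using assms(2-) by (intro continuous_intros) (auto dest: qpoch_nz_mono)
  have contg: "isCont g a" unfolding g_def using assms by (intro continuous_intros) auto
  have "f a = g a" by (rule continuous_eq_off_finite[OF contf contg fin eq])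
  then have "s a = (1-a) * P (a*q) N * P (a*q/(B*C)) N / (P (a*q/B) N * P (a*q/C) N)"
    unfolding f_def g_def using assms(4,5) by (simp add: nonzero_eq_divide_eq mult_ac)
  then show ?thesis unfolding s_def .
qed

section \<open>Reading q-Pochhammer symbols backwards\<close>

abbreviation T :: "nat \<Rightarrow> complex" where "T n \<equiv> q ^ (n choose 2)"

lemma T_0 [simp]: "T 0 = 1" by (simp add: numeral_2_eq_2)

lemma T_Suc: "T (Suc n) = T n * q^n"
  by (simp add: numeral_2_eq_2 power_add mult_ac)

lemma T_add: "T (m + j) = T m * T j * q^(m*j)"
  by (induction j) (simp_all add: T_Suc power_add mult_ac del: binomial_Suc_Suc)

lemma T_square: "T n * T n * q^n = (q^n)^n"
proof (induction n)
  case (Suc n)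
  have "T (Suc n) * T (Suc n) * q^Suc n = (T n * T n * q^n) * q^n * q^Suc n"
    by (simp add: T_Suc mult_ac)
  also have "\<dots> = (q^Suc n)^Suc n" unfolding Suc.IH by (simp add: power_mult_distrib mult_ac)
  finally show ?case .
qed simp

lemma T_nz [simp]: "T n \<noteq> 0" using q_nz by simp

text \<open>
  Factor by factor, \<open>1 - q^(1-n+k)/x\<close> is \<open>-q^(1-n+k)/x\<close> times \<open>1 - x q^(n-1-k)\<close>.
\<close>
lemma P_reflect: "x \<noteq> 0 \<Longrightarrow> T n * (-x)^n * P (q/(q^n*x)) n = P x n"
proof (induction n)
  case (Suc n)
  have "P (q/(q^Suc n*x)) (Suc n) = (1 - 1/(q^n*x)) * P (q/(q^n*x)) n"
    using q_nz by (simp add: qpoch_Suc_left)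
  then have "T (Suc n) * (-x)^Suc n * P (q/(q^Suc n*x)) (Suc n)
      = (T n * (-x)^n * P (q/(q^n*x)) n) * (q^n * (-x) * (1 - 1/(q^n*x)))"
    by (simp only: T_Suc power_Suc mult_ac)
  also have "q^n * (-x) * (1 - 1/(q^n*x)) = 1 - x*q^n"
    using q_nz Suc.prems by (simp add: field_simps)
  finally show ?case using Suc by (simp add: qpoch_Suc)
qed simp

text \<open>
  The reflection of the last \<open>n - j\<close> factors only. The quotient \<open>(q^(-j);q)_j / (q;q)_j\<close> is a
  sign times a power of \<open>q\<close>; it stays in this form because \<open>watson_inner\<close> produces the same
  quotient.
\<close>
lemma reflect_tail:
  assumes "x \<noteq> 0" "j \<le> n"
  shows "T n * (-x)^n * P (q/(q^n*x)*q^j) (n-j) = P x (n-j) * (q^n*x)^j * (P (1/q^j) j / P q j)"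
proof -
  obtain m where n: "n = m + j" using assms(2) by (metis le_add_diff_inverse2)
  have 1: "T m * (-x)^m * P (q/(q^m*x)) m = P x m" using P_reflect assms(1) by simp
  have "q/(q^j*q) = 1/q^j" using q_nz by simp
  then have "T j * (-q)^j * P (1/q^j) j = P q j" using P_reflect[of q j] q_nz by simp
  then have 2: "P (1/q^j) j / P q j = 1 / (T j * (-q)^j)" using q_nz
    by (simp add: field_simps)
  have 3: "q/(q^n*x)*q^j = q/(q^m*x)" using q_nz by (simp add: n power_add)
  have "T n * (-x)^n * P (q/(q^m*x)) m = P x m * (T j * (-x)^j * q^(m*j))"
    unfolding 1[symmetric] n T_add by (simp add: power_add mult_ac)
  also have "T j * (-x)^j * q^(m*j) = (q^n*x)^j / (T j * (-q)^j)"
  proof -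
    have "(q^n*x)^j = q^(m*j) * (q^j)^j * x^j"
    proof -
      have "(q^n)^j = q^(m*j) * (q^j)^j"
        by (simp add: n power_add power_mult_distrib flip: power_mult)
      then show ?thesis by (simp add: power_mult_distrib)
    qed
    also have "\<dots> = (T j * (-x)^j * q^(m*j)) * (T j * (-q)^j)"
      unfolding T_square[symmetric] power_minus[of x] power_minus[of q]
      by (simp add: mult_ac flip: power_mult_distrib)
    finally show ?thesis using q_nz by simp
  qed
  finally show ?thesis unfolding 3 2 by (simp add: n)
qed

section \<open>Transformation of Watson\<close>

lemma avoids_iff: "avoids as q n \<longleftrightarrow> (\<forall>a\<in>set as. P a n \<noteq> 0)"
proof -
  have "a * q ^ k = 1 \<longleftrightarrow> a = q powi (- int k)" for a k
    using q_nz by (simp add: power_int_minus field_simps)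
  then show ?thesis unfolding avoids_def qpoch_eq_0_iff by auto
qed

lemma W87_okD:
  assumes "W87_ok b n c d e f q"
  shows "P (q^(n+1)*b) n \<noteq> 0" "P (q*b/c) n \<noteq> 0" "P (q*b/d) n \<noteq> 0" "P (q*b/e) n \<noteq> 0" "P (q*b/f) n \<noteq> 0"
    "0 < n \<Longrightarrow> b \<noteq> 1"
  using assms unfolding W87_ok_def W87_den_def avoids_iff by (auto simp: qpoch_eq_0_iff)

text \<open>
  The four factors containing \<open>sqrt b\<close> collapse to \<open>(1 - b q^(2k)) / (1 - b)\<close>. For \<open>n = 0\<close> the
  condition \<open>W87_ok\<close> admits \<open>b = 1\<close>, where this quotient is not the term of the series.
\<close>
lemma W87_eq:
  assumes "W87_ok b n c d e f q" "0 < n"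
  shows "W87 b n c d e f q z = (\<Sum>k\<le>n. (1 - b*q^(2*k)) / (1-b) * P b k * P (1/q^n) k * P c k * P d k
      * P e k * P f k
     / (P q k * P (q^(n+1)*b) k * P (q*b/c) k * P (q*b/d) k * P (q*b/e) k * P (q*b/f) k) * z^k)"
  unfolding W87_def
proof (intro sum.cong refl)
  fix k assume "k \<in> {..n}"
  define s where "s = csqrt b"
  have b: "b = s*s" unfolding s_def by (simp flip: power2_eq_square)
  have "P s n \<noteq> 0" "P (-s) n \<noteq> 0"
    using assms(1) unfolding W87_ok_def W87_den_def avoids_iff s_def by auto
  then have nz: "P s k \<noteq> 0" "P (-s) k \<noteq> 0" "1 - s \<noteq> 0" "1 + s \<noteq> 0"
    using \<open>k \<in> {..n}\<close> assms(2) qpoch_nz_mono[of s q n] qpoch_nz_mono[of "-s" q n]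
      qpoch_nz_mono[of s q n 1] qpoch_nz_mono[of "-s" q n 1]
    by (auto simp: qpoch_Suc)
  have 1: "P (q*s) k = P s k * (1 - s*q^k) / (1 - s)"
    using qpoch_Suc[of s q k] qpoch_Suc_left[of s q k] nz by (simp add: field_simps)
  have 2: "P (-q*s) k = P (-s) k * (1 + s*q^k) / (1 + s)"
    using qpoch_Suc[of "-s" q k] qpoch_Suc_left[of "-s" q k] nz by (simp add: field_simps)
  have "(P (q*s) k * P (-q*s) k) / (P s k * P (-s) k) = ((1 - s*q^k) * (1 + s*q^k)) / ((1 - s) * (1 + s))"
    unfolding 1 2 using nz by simp
  also have "(1 - s*q^k) * (1 + s*q^k) = 1 - b*q^(2*k)"
    unfolding mult_2 power_add by (simp add: b algebra_simps)
  also have "(1 - s) * (1 + s) = 1 - b" by (simp add: b algebra_simps)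
  finally have 3: "(P (q*s) k * P (-q*s) k) / (P s k * P (-s) k) = (1 - b*q^(2*k)) / (1-b)" .
  have 4: "q powi (- int n) = 1/q^n" by (simp add: power_int_minus inverse_eq_divide)
  show "qpochs (W87_num (csqrt b) b n c d e f q) q k / qpochs (W87_den (csqrt b) b n c d e f q) q k * z ^ k
    = (1 - b*q^(2*k)) / (1-b) * P b k * P (1/q^n) k * P c k * P d k * P e k * P f k
     / (P q k * P (q^(n+1)*b) k * P (q*b/c) k * P (q*b/d) k * P (q*b/e) k * P (q*b/f) k) * z^k"
    unfolding W87_num_def W87_den_def qpochs_def 3[symmetric] 4 s_def[symmetric]
    by (simp add: mult_ac)
qed

text \<open>
  With \<open>k = j + m\<close> and the values at \<open>m = 0\<close> taken out, what remains is a \<open>6W5\<close> of length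
  \<open>n - j\<close> with base \<open>b q^(2j)\<close> and parameters \<open>c q^j, d q^j\<close>.
\<close>
lemma watson_inner:
  assumes "b \<noteq> 0" "c \<noteq> 0" "d \<noteq> 0" "P (q*b/c) n \<noteq> 0" "P (q*b/d) n \<noteq> 0" "P (q^(n+1)*b) n \<noteq> 0" "j \<le> n"
  defines "y \<equiv> q^(n+1)*b/(c*d)"
  shows "(\<Sum>m\<le>n-j. (1 - b*q^(2*(j+m))) * P b (j+m) * P (1/q^n) (j+m) * P c (j+m) * P d (j+m)
            / (P q (j+m) * P (q^(n+1)*b) (j+m) * P (q*b/c) (j+m) * P (q*b/d) (j+m)) * y^(j+m)
            * (P (1/q^(j+m)) j * P (b*q^(j+m)) j))
       = (1-b) * P (q*b) n * P (1/q^n) j * P c j * P d j * P (q*b/(c*d)) (n-j)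
          / (P (q*b/c) n * P (q*b/d) n) * y^j * (P (1/q^j) j / P q j)"
    (is "?L = ?R")
proof -
  define a where "a = b*q^(2*j)"
  define N where "N = n - j"
  have n: "n = j + N" using assms by (simp add: N_def)
  have q2: "q^(2*j) = q^j*q^j" by (simp add: mult_2 power_add)
  have aB: "a*q/(c*q^j) = q*b/c*q^j" "a*q/(d*q^j) = q*b/d*q^j" "a*q/((c*q^j)*(d*q^j)) = q*b/(c*d)"
      "a*q^(N+1) = q^(n+1)*b*q^j"
    using q_nz unfolding a_def q2 by (simp_all add: n power_add)
  have a0: "a \<noteq> 0" using assms(1) q_nz by (simp add: a_def)
  have split: "P x (j+m) = P x j * P (x*q^j) m" for x m by (rule qpoch_add)
  have nz: "P (q*b/c) j \<noteq> 0" "P (q*b/c*q^j) N \<noteq> 0" "P (q*b/d) j \<noteq> 0" "P (q*b/d*q^j) N \<noteq> 0"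
     "P (q^(n+1)*b) j \<noteq> 0" "P (q^(n+1)*b*q^j) N \<noteq> 0"
    using assms(4-6) unfolding n split by auto
  define K where "K = P b (2*j) * P (1/q^n) j * P c j * P d j / (P (q^(n+1)*b) j * P (q*b/c) j
      * P (q*b/d) j)
      * y^j * (P (1/q^j) j / P q j)"
  have "?L = (\<Sum>m\<le>N. K * ((1 - a*q^(2*m)) * P a m * P (c*q^j) m * P (d*q^j) m * P (1/q^N) m
             / (P q m * P (a*q/(c*q^j)) m * P (a*q/(d*q^j)) m * P (a*q^(N+1)) m)
                 * (a*q^(N+1)/((c*q^j)*(d*q^j)))^m))"
    unfolding N_def[symmetric]
  proof (intro sum.cong refl)
    fix m
    have e1: "1 - b*q^(2*(j+m)) = 1 - a*q^(2*m)" by (simp add: a_def power_add distrib_left)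
    have e2: "P b (j+m) * P (b*q^(j+m)) j = P b (2*j) * P a m"
      by (simp add: a_def flip: qpoch_add) (simp add: mult_2 add_ac)
    have e3: "P (1/q^n) (j+m) = P (1/q^n) j * P (1/q^N) m" using q_nz by (simp add: split n power_add)
    have e4: "P (1/q^(j+m)) j / P q (j+m) = (P (1/q^j) j / P q j) / (q^(j*m) * P q m)"
    proof -
      have "q/(q^j*q) = 1/q^j" "q/(q^j*q^(m+1)) = 1/q^(j+m)" using q_nz by (simp_all add: power_add)
      then have r: "T j * (-q)^j * P (1/q^j) j = P q j"
          "T j * (-(q^(m+1)))^j * P (1/q^(j+m)) j = P (q^(m+1)) j"
        using P_reflect[of q j] P_reflect[of "q^(m+1)" j] q_nz by simp_all
      have p: "P q (j+m) = P q m * P (q^(m+1)) j" using qpoch_add[of q q m j] by (simp add: add_ac)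
      then have "P (q^(m+1)) j \<noteq> 0" using P_q_nz[of "j+m"] by auto
      then have r': "P (1/q^(j+m)) j / P (q^(m+1)) j = 1 / (T j * (-(q^(m+1)))^j)"
        using q_nz unfolding r(2)[symmetric] by auto
      have "(-(q^(m+1)))^j = (-q)^j * q^(j*m)"
        unfolding power_minus[of "q^(m+1)"] power_minus[of q]
        by (simp add: power_mult_distrib mult_ac flip: power_mult)
      moreover have "P (1/q^j) j / P q j = 1 / (T j * (-q)^j)"
        using r(1) P_q_nz[of j] q_nz by (simp add: divide_eq_eq eq_divide_eq mult_ac)
      moreover have "P (1/q^(j+m)) j / P q (j+m) = (P (1/q^(j+m)) j / P (q^(m+1)) j) / P q m"
        unfolding p by simp
      ultimately show ?thesis unfolding r' by (simp add: mult_ac)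
    qed
    show "(1 - b*q^(2*(j+m))) * P b (j+m) * P (1/q^n) (j+m) * P c (j+m) * P d (j+m)
            / (P q (j+m) * P (q^(n+1)*b) (j+m) * P (q*b/c) (j+m) * P (q*b/d) (j+m)) * y^(j+m)
            * (P (1/q^(j+m)) j * P (b*q^(j+m)) j)
      = K * ((1 - a*q^(2*m)) * P a m * P (c*q^j) m * P (d*q^j) m * P (1/q^N) m
             / (P q m * P (a*q/(c*q^j)) m * P (a*q/(d*q^j)) m * P (a*q^(N+1)) m)
                 * (a*q^(N+1)/((c*q^j)*(d*q^j)))^m)"
    proof -
      have y: "y^(j+m) = y^j * (y/q^j)^m * q^(j*m)" using q_nz
        by (simp add: power_add power_divide power_mult)
      have y2: "a*q^(N+1)/((c*q^j)*(d*q^j)) = y/q^j"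
        using q_nz unfolding aB y_def by (simp add: mult_ac)
      have qi: "inverse (q^(j*m)) * q^(j*m) = 1" using q_nz by simp
      have "(1 - b*q^(2*(j+m))) * P b (j+m) * P (1/q^n) (j+m) * P c (j+m) * P d (j+m)
            / (P q (j+m) * P (q^(n+1)*b) (j+m) * P (q*b/c) (j+m) * P (q*b/d) (j+m)) * y^(j+m)
            * (P (1/q^(j+m)) j * P (b*q^(j+m)) j)
         = (1 - b*q^(2*(j+m))) * (P b (j+m) * P (b*q^(j+m)) j) * P (1/q^n) (j+m) * P c (j+m) * P d (j+m)
            / (P (q^(n+1)*b) (j+m) * P (q*b/c) (j+m) * P (q*b/d) (j+m)) * y^(j+m)
            * (P (1/q^(j+m)) j / P q (j+m))"
        by (simp add: mult_ac)
      also have "\<dots> = K * ((1 - a*q^(2*m)) * P a m * P (c*q^j) m * P (d*q^j) m * P (1/q^N) m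
             / (P q m * P (q*b/c*q^j) m * P (q*b/d*q^j) m * P (q^(n+1)*b*q^j) m) * (y/q^j)^m)
             * (inverse (q^(j*m)) * q^(j*m))"
        unfolding e1 e2 e3 e4 split[of "q^(n+1)*b"] split[of "q*b/c"] split[of "q*b/d"] split[of c]
            split[of d] y K_def
        by (simp only: divide_inverse inverse_mult_distrib mult_ac)
      finally show ?thesis unfolding y2 qi unfolding aB by simp
    qed
  qed
  also have "\<dots> = K * ((1-a) * P (a*q) N * P (q*b/(c*d)) N / (P (q*b/c*q^j) N * P (q*b/d*q^j) N))"
    unfolding sum_distrib_left[symmetric]
    using sum_6W5[of a "c*q^j" "d*q^j" N] assms(1-3) q_nz nz a0 unfolding aB
    by simp
  also have "\<dots> = ?R"
  proof -
    have 1: "P b (2*j) * (1-a) * P (a*q) N = (1-b) * P (q*b) n * P (q^(n+1)*b) j"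
    proof -
      have "P b (2*j) * (1-a) * P (a*q) N = P b (2*j + Suc N)"
        unfolding qpoch_add qpoch_Suc_left[of _ q N] a_def by simp
      also have "2*j + Suc N = Suc (n + j)" using n by simp
      also have "P b (Suc (n + j)) = (1-b) * P (b*q) n * P (b*q*q^n) j"
        by (simp add: qpoch_Suc_left qpoch_add)
      finally show ?thesis by (simp add: mult_ac)
    qed
    have 2: "P (q*b/c) n = P (q*b/c) j * P (q*b/c*q^j) N" "P (q*b/d) n = P (q*b/d) j * P (q*b/d*q^j) N"
      unfolding n split by auto
    have "K * ((1-a) * P (a*q) N * P (q*b/(c*d)) N / (P (q*b/c*q^j) N * P (q*b/d*q^j) N))
       = (P b (2*j) * (1-a) * P (a*q) N) * P (1/q^n) j * P c j * P d j
           * P (q*b/(c*d)) N / (P (q^(n+1)*b) j * (P (q*b/c) n * P (q*b/d) n))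
      * y^j * (P (1/q^j) j / P q j)"
      unfolding K_def 2 by (simp add: mult_ac)
    also have "\<dots> = ?R" unfolding 1 unfolding N_def using nz by simp
    finally show ?thesis .
  qed
  finally show ?thesis .
qed

text \<open>
  A terminating \<open>4\<phi>3\<close> with argument \<open>q\<close>, multiplied by \<open>(D, E, F; q)_n\<close>. It is a polynomial in
  \<open>A, B, C, D, E, F\<close>, so identities between such sums extend by continuity to vanishing
  denominators.
\<close>
definition cleared_phi43 :: "nat \<Rightarrow> complex \<Rightarrow> complex \<Rightarrow> complex \<Rightarrow> complex \<Rightarrow> complex \<Rightarrow> complex \<Rightarrow> complex"
    where
  "cleared_phi43 n A B C D E F = (\<Sum>j\<le>n. P (1/q^n) j * P A j * P B j * P C j / P q j * q^j
      * P (D*q^j) (n-j) * P (E*q^j) (n-j) * P (F*q^j) (n-j))"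

lemma cleared_phi43_perm:
  "cleared_phi43 n A B C D E F = cleared_phi43 n B A C D E F"
      "cleared_phi43 n A B C D E F = cleared_phi43 n A C B D E F"
  "cleared_phi43 n A B C D E F = cleared_phi43 n A B C E D F"
      "cleared_phi43 n A B C D E F = cleared_phi43 n A B C D F E"
  by (simp_all add: cleared_phi43_def mult_ac)

lemma phi43_times_denominators:
  assumes "phi43_ok n D E F q"
  shows "phi43 n A B C D E F q q * (P D n * P E n * P F n) = cleared_phi43 n A B C D E F"
    and "P D n \<noteq> 0" "P E n \<noteq> 0" "P F n \<noteq> 0"
proof -
  show nz: "P D n \<noteq> 0" "P E n \<noteq> 0" "P F n \<noteq> 0"
    using assms unfolding phi43_ok_def avoids_iff by auto
  have 4: "q powi (- int n) = 1/q^n" by (simp add: power_int_minus inverse_eq_divide)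
  show "phi43 n A B C D E F q q * (P D n * P E n * P F n) = cleared_phi43 n A B C D E F"
    unfolding phi43_def cleared_phi43_def sum_distrib_right
  proof (intro sum.cong refl)
    fix j assume "j \<in> {..n}"
    then have j: "j \<le> n" by simp
    have nzj: "P D j \<noteq> 0" "P E j \<noteq> 0" "P F j \<noteq> 0" using nz j qpoch_nz_mono by blast+
    show "qpochs [q powi (- int n), A, B, C] q j / qpochs [q, D, E, F] q j * q ^ j * (P D n * P E n * P F n)
      = P (1/q^n) j * P A j * P B j * P C j / P q j * q^j
      * P (D*q^j) (n-j) * P (E*q^j) (n-j) * P (F*q^j) (n-j)"
      unfolding qpochs_def 4 qpoch_split[OF j, of D] qpoch_split[OF j, of E] qpoch_split[OF j, of F]
      using nzj by simp
  qed
qed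

text \<open>
  The common normal form of all expressions in the theorem. It distinguishes the pair \<open>c, d\<close>
  from the pair \<open>e, f\<close>; the power in front of the series makes it symmetric in all four.
\<close>
definition Om :: "nat \<Rightarrow> complex \<Rightarrow> complex \<Rightarrow> complex \<Rightarrow> complex \<Rightarrow> complex \<Rightarrow> complex" where
  "Om n b c d e f = T n * (-(q*b/(c*d)))^n * cleared_phi43 n (q*b/(e*f)) c d (c*d/(q^n*b)) (q*b/e) (q*b/f)"

text \<open>
  Watson's transformation in a form multiplied by the denominators of both sides. The factor
  \<open>(e,f;q)_k / (qb/e,qb/f;q)_k (qb/(ef))^k\<close> of the \<open>k\<close>-th term is expanded by \<open>saalschuetz\<close>; the
  summation over \<open>k\<close>, now the inner one, is \<open>watson_inner\<close>.
\<close>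
lemma watson:
  assumes nz: "b \<noteq> 0" "c \<noteq> 0" "d \<noteq> 0" "e \<noteq> 0" "f \<noteq> 0" and ok: "W87_ok b n c d e f q"
  shows "W87 b n c d e f q (q^(n+2)*b\<^sup>2/(c*d*e*f)) * (P (q*b/c) n * P (q*b/d) n * P (q*b/e) n * P (q*b/f) n)
       = P (q*b) n * Om n b c d e f"
proof (cases "n = 0")
  case True
  then show ?thesis
    by (simp add: W87_def qpochs_def W87_num_def W87_den_def Om_def cleared_phi43_def)
next
  case False
  define g E F where g: "g = q*b/(e*f)" and E: "E = q*b/e" and F: "F = q*b/f"
  define y where y: "y = q^(n+1)*b/(c*d)"
  note okD = W87_okD[OF ok, folded E F]
  have b1: "1 - b \<noteq> 0" using okD False by auto
  have EFk: "P E k \<noteq> 0" "P F k \<noteq> 0" if "k \<le> n" for k using okD that qpoch_nz_mono by blast+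
  define w where "w = (\<lambda>k. (1 - b*q^(2*k)) * P b k * P (1/q^n) k * P c k * P d k
            / (P q k * P (q^(n+1)*b) k * P (q*b/c) k * P (q*b/d) k) * y^k)"
  define h where "h = (\<lambda>j. P g j / (P q j * P E j * P F j) * q^j)"
  have z: "q^(n+2)*b\<^sup>2/(c*d*e*f) = y*g" using nz by (simp add: y g power2_eq_square mult_ac)
  have "(1-b) * W87 b n c d e f q (q^(n+2)*b\<^sup>2/(c*d*e*f))
      = (\<Sum>k\<le>n. w k * (P e k * P f k * g^k / (P E k * P F k)))"
    unfolding W87_eq[OF ok False[unfolded neq0_conv]] sum_distrib_left z
    by (intro sum.cong refl) (use b1 in \<open>simp add: w_def E F power_mult_distrib mult_ac\<close>)
  also have "\<dots> = (\<Sum>k\<le>n. \<Sum>j\<le>k. w k * (P (1/q^k) j * P (b*q^k) j) * h j)"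
  proof (intro sum.cong refl)
    fix k assume "k \<in> {..n}"
    then have s: "(\<Sum>j\<le>k. P (1/q^k) j * P (b*q^k) j * P g j / (P q j * P E j * P F j) * q^j)
       = P e k * P f k * g^k / (P E k * P F k)"
      using saalschuetz[of b e f k, folded g E F] nz EFk by simp
    show "w k * (P e k * P f k * g^k / (P E k * P F k)) = (\<Sum>j\<le>k. w k * (P (1/q^k) j * P (b*q^k) j) * h j)"
      unfolding s[symmetric] sum_distrib_left h_def by (simp add: mult_ac)
  qed
  also have "\<dots> = (\<Sum>j\<le>n. h j * (\<Sum>m\<le>n-j. w (j+m) * (P (1/q^(j+m)) j * P (b*q^(j+m)) j)))"
    unfolding sum_triangle_shift sum_distrib_left by (simp add: mult_ac)
  also have "\<dots> = (\<Sum>j\<le>n. h j * ((1-b) * P (q*b) n * P (1/q^n) j * P c j * P d j * P (q*b/(c*d)) (n-j)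
          / (P (q*b/c) n * P (q*b/d) n) * y^j * (P (1/q^j) j / P q j)))"
    using watson_inner[of b c d n, folded y] nz okD unfolding w_def by (intro sum.cong refl) auto
  finally have eq: "(1-b) * W87 b n c d e f q (q^(n+2)*b\<^sup>2/(c*d*e*f)) = \<dots>" .
  have "(1-b) * (W87 b n c d e f q (q^(n+2)*b\<^sup>2/(c*d*e*f)) * (P (q*b/c) n * P (q*b/d) n * P E n * P F n))
     = ((1-b) * W87 b n c d e f q (q^(n+2)*b\<^sup>2/(c*d*e*f))) * (P (q*b/c) n * P (q*b/d) n * P E n * P F n)"
    by simp
  also have "\<dots> = (1-b) * (P (q*b) n * Om n b c d e f)"
    unfolding eq Om_def cleared_phi43_def sum_distrib_left sum_distrib_right
  proof (intro sum.cong refl)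
    fix j assume "j \<in> {..n}"
    then have j: "j \<le> n" by simp
    have x: "q*b/(c*d) \<noteq> 0" "q/(q^n*(q*b/(c*d))) = c*d/(q^n*b)" "q^n*(q*b/(c*d)) = y"
      using nz q_nz by (simp_all add: y)
    note rt = reflect_tail[OF x(1) j, unfolded x(2), unfolded x(3)]
    have "(1-b) * (P (q*b) n * (T n * (-(q*b/(c*d)))^n * (P (1/q^n) j * P g j * P c j * P d j / P q j * q^j
      * P (c*d/(q^n*b)*q^j) (n-j) * P (E*q^j) (n-j) * P (F*q^j) (n-j))))
      = (1-b) * (P (q*b) n * (P (1/q^n) j * P g j * P c j * P d j / P q j * q^j
         * (T n * (-(q*b/(c*d)))^n * P (c*d/(q^n*b)*q^j) (n-j)) * P (E*q^j) (n-j) * P (F*q^j) (n-j)))"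
      by (simp only: mult_ac)
    also have "\<dots> = h j * ((1-b) * P (q*b) n * P (1/q^n) j * P c j * P d j * P (q*b/(c*d)) (n-j)
          / (P (q*b/c) n * P (q*b/d) n) * y^j * (P (1/q^j) j / P q j)) * (P (q*b/c) n * P (q*b/d) n
              * P E n * P F n)"
      unfolding rt h_def qpoch_split[OF j, of E] qpoch_split[OF j, of F] using okD EFk[OF j] by simp
    finally show "h j * ((1-b) * P (q*b) n * P (1/q^n) j * P c j * P d j * P (q*b/(c*d)) (n-j)
          / (P (q*b/c) n * P (q*b/d) n) * y^j * (P (1/q^j) j / P q j)) * (P (q*b/c) n * P (q*b/d) n
              * P E n * P F n)
      = (1-b) * (P (q*b) n * (T n * (-(q*b/(c*d)))^n * (P (1/q^n) j * P (q*b/(e*f)) j * P c j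
          * P d j / P q j * q^j
      * P (c*d/(q^n*b)*q^j) (n-j) * P (q*b/e*q^j) (n-j) * P (q*b/f*q^j) (n-j))))" unfolding g E F by simp
  qed
  finally show ?thesis using b1 unfolding E F by simp
qed

section \<open>Symmetry and the transformation of Sears\<close>

lemma Om_swap_outer:
  "Om n b c d e f = Om n b d c e f" "Om n b c d e f = Om n b c d f e"
  unfolding Om_def
  using cleared_phi43_perm(2)[of n "q*b/(e*f)" c d "c*d/(q^n*b)" "q*b/e" "q*b/f"]
    cleared_phi43_perm(4)[of n "q*b/(e*f)" c d "c*d/(q^n*b)" "q*b/e" "q*b/f"]
  by (simp_all add: mult.commute[of d c] mult.commute[of f e])

lemma W87_swap: "W87 b n c d e f q z = W87 b n c e d f q z" "W87_ok b n c d e f q = W87_ok b n c e d f q"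
  by (auto simp: W87_def W87_ok_def W87_num_def W87_den_def qpochs_def avoids_def mult_ac)

text \<open>
  For all but finitely many \<open>b\<close>, both sides equal the same multiple of the same \<open>8W7\<close>, which is
  symmetric in its parameters; continuity in \<open>b\<close> covers the others.
\<close>
lemma Om_swap:
  assumes "b \<noteq> 0" "c \<noteq> 0" "d \<noteq> 0" "e \<noteq> 0" "f \<noteq> 0"
  shows "Om n b c d e f = Om n b c e d f"
proof -
  \<comment> \<open>the values of \<open>b\<close> for which Watson's transformation applies and \<open>(qb;q)_n\<close> can be cancelled\<close>
  have key: "Om n t c d e f = Om n t c e d f"
    if t: "t \<noteq> 0" "\<And>j. j \<le> 2*n \<Longrightarrow> t*q^j \<noteq> 1" 
       "P (q*t/c) n \<noteq> 0" "P (q*t/d) n \<noteq> 0" "P (q*t/e) n \<noteq> 0" "P (q*t/f) n \<noteq> 0" for t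
  proof -
    have "csqrt t * q^k \<noteq> 1" "- csqrt t * q^k \<noteq> 1" if "k < n" for k
    proof -
      have "(csqrt t * q^k)^2 \<noteq> 1" using t(2)[of "2*k"] that
        by (simp add: power_mult_distrib flip: power_mult) (simp add: mult.commute)
      then show "csqrt t * q^k \<noteq> 1" "- csqrt t * q^k \<noteq> 1"
          by (auto simp: power2_eq_1_iff) (metis minus_minus)
    qed
    then have s: "P (csqrt t) n \<noteq> 0" "P (- csqrt t) n \<noteq> 0" unfolding qpoch_eq_0_iff by auto
    have "P (q^(n+1)*t) n \<noteq> 0" unfolding qpoch_eq_0_iff
      using t(2)[of "n+1+_"] by (auto simp: power_add mult_ac)
    with s t have ok: "W87_ok t n c d e f q" by (simp add: W87_ok_def W87_den_def avoids_iff)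
    have "P (q*t) n \<noteq> 0" unfolding qpoch_eq_0_iff
      using t(2)[of "1+_"] by (auto simp: power_add mult_ac)
    then show ?thesis
      using watson[of t c d e f n] watson[of t c e d f n] ok W87_swap assms t(1)
      by (simp add: mult_ac)
  qed
  define A where "A = {0} \<union> {t. \<exists>j\<le>2*n. t * 1 * q ^ j = 1} \<union> {t. \<exists>j\<le>n. t * (q/c) * q ^ j
      = 1} \<union> {t. \<exists>j\<le>n. t * (q/d) * q ^ j = 1}
     \<union> {t. \<exists>j\<le>n. t * (q/e) * q ^ j = 1} \<union> {t. \<exists>j\<le>n. t * (q/f) * q ^ j = 1}"
  have fin: "finite A" unfolding A_def using assms q_nz by (intro finite_UnI finite_geom) auto
  have eq: "Om n t c d e f = Om n t c e d f" if "t \<notin> A" for t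
    by (rule key) (use that in \<open>auto simp: A_def qpoch_eq_0_iff mult_ac\<close>)
  have cont: "isCont (\<lambda>t. Om n t c d e f) b" if "c \<noteq> 0" "d \<noteq> 0" "e \<noteq> 0" "f \<noteq> 0" for c d e f
    unfolding Om_def cleared_phi43_def using that assms(1) q_nz by (intro continuous_intros) auto
  show ?thesis
    by (rule continuous_eq_off_finite[OF cont cont fin eq]) (use assms in auto)
qed

lemma Om_perms:
  assumes "t \<noteq> 0" "x1 \<noteq> 0" "x2 \<noteq> 0" "x3 \<noteq> 0" "x4 \<noteq> 0"
  shows "Om m t x1 x2 x3 x4 = Om m t x1 x4 x2 x3" "Om m t x1 x2 x3 x4 = Om m t x2 x3 x1 x4"
    "Om m t x1 x2 x3 x4 = Om m t x2 x1 x3 x4" "Om m t x1 x2 x3 x4 = Om m t x4 x1 x2 x3"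
    "Om m t x1 x2 x3 x4 = Om m t x4 x2 x1 x3"
  using Om_swap Om_swap_outer assms by metis+

text \<open>
  The exchange of \<open>d\<close> and \<open>e\<close> in \<open>Om\<close> keeps the numerator parameter \<open>c\<close> and the denominator
  parameter \<open>qb/f\<close> of the \<open>4\<phi>3\<close>; here these are \<open>A\<close> and \<open>D\<close>. The hypothesis \<open>bal\<close> says that the
  \<open>4\<phi>3\<close> is balanced; it makes the parameters expressible through some \<open>b, c, d, e, f\<close>.
\<close>
lemma sears:
  assumes nz: "A \<noteq> 0" "B \<noteq> 0" "C \<noteq> 0" "D \<noteq> 0" "E \<noteq> 0" "F \<noteq> 0" and bal: "A*B*C*q = q^n*D*E*F"
  shows "cleared_phi43 n A B C D E F = (B*C/D)^n
      * cleared_phi43 n A (D/B) (D/C) D (A*q/(q^n*E)) (A*q/(q^n*F))"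
proof -
  \<comment> \<open>chosen so that \<open>C\<close> and \<open>e\<close> are exchanged while \<open>A\<close> and \<open>D = qb/f\<close> remain\<close>
  define b where b: "b = A*C/(q^n*E)"
  define e where e: "e = D/B"
  have b0: "b \<noteq> 0" "e \<noteq> 0" using nz q_nz by (simp_all add: b e)
  have b2: "q*b = D*F/B" using nz q_nz bal by (simp add: b field_simps)
  have s: "q*b/(e*(q*b/D)) = B" "A*C/(q^n*b) = E" "q*b/e = F" "q*b/(q*b/D) = D"
    "q*b/(C*(q*b/D)) = D/C" "A*e/(q^n*b) = A*q/(q^n*F)" "q*b/C = A*q/(q^n*E)"
  proof -
    have eb: "e = q*b/F" using nz unfolding b2 e by simp
    show "q*b/(e*(q*b/D)) = B" using nz b0 q_nz unfolding e by simp
    show "q*b/e = F" using nz unfolding b2 e by simp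
    show "A*e/(q^n*b) = A*q/(q^n*F)" using b0 unfolding eb by simp
    show "A*C/(q^n*b) = E" "q*b/C = A*q/(q^n*E)" using nz q_nz unfolding b by simp_all
  qed (use nz b0 q_nz in simp_all)
  define M where M: "M = -(q*b/(A*C))"
  have m1: "T n * (-(q*b/(A*C)))^n * cleared_phi43 n B A C E F D
      = T n * (-(q*b/(A*e)))^n * cleared_phi43 n (D/C) A e (A*q/(q^n*F)) (A*q/(q^n*E)) D"
    using Om_swap[of b A C e "q*b/D" n] nz b0 q_nz unfolding Om_def s by simp
  have m2: "-(q*b/(A*e)) = (C/e) * M" using nz b0 unfolding M by simp
  have M0: "M \<noteq> 0" using nz b0 q_nz unfolding M by simp
  define X Y where X: "X = cleared_phi43 n B A C E F D" and Y: "Y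
      = cleared_phi43 n (D/C) A e (A*q/(q^n*F)) (A*q/(q^n*E)) D"
  have "T n * M^n * X = T n * ((C/e)*M)^n * Y"
    using m1 unfolding X[symmetric] Y[symmetric] m2 M[symmetric] .
  then have "M^n * X = M^n * ((C/e)^n * Y)"
    unfolding power_mult_distrib using T_nz[of n] by (simp only: mult_ac mult_cancel_left) auto
  with M0 have "X = (C/e)^n * Y" by simp
  moreover have "C/e = B*C/D" by (simp add: e)
  ultimately have "cleared_phi43 n B A C E F D
      = (B*C/D)^n * cleared_phi43 n (D/C) A (D/B) (A*q/(q^n*F)) (A*q/(q^n*E)) D"
    unfolding X Y e by (simp add: mult_ac)
  then show ?thesis by (metis cleared_phi43_perm)
qed

end

section \<open>Other forms of the symmetric sum\<close>

locale parameters = q_base +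
  fixes n :: nat and b c d e f :: complex
  assumes nz: "b \<noteq> 0" "c \<noteq> 0" "d \<noteq> 0" "e \<noteq> 0" "f \<noteq> 0"
begin

abbreviation u where "u \<equiv> q^n"

lemma T_sq: "T n * T n = (u/q)^n"
  using T_square[of n] q_nz by (simp add: power_divide field_simps flip: power_mult)

lemma reflect: "x \<noteq> 0 \<Longrightarrow> y = q/(u*x) \<Longrightarrow> P y n * (T n * (-x)^n) = P x n"
  using P_reflect[of x n] by (simp add: mult_ac)

text \<open>
  An even number of factors \<open>q^(n choose 2)\<close> combines into an \<open>n\<close>-th power, which reduces an
  identity between prefactors to an identity between bases.
\<close>
lemma T_power_product3: "u/q * (x1*x2*x3) = y \<Longrightarrow> (T n*x1^n) * (T n*x2^n) * (T n*x3^n) = T n * y^n"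
proof -
  assume y: "u/q * (x1*x2*x3) = y"
  have "(T n*x1^n) * (T n*x2^n) * (T n*x3^n) = T n * ((T n * T n) * (x1*x2*x3)^n)"
    by (simp only: power_mult_distrib mult_ac)
  then show ?thesis unfolding T_sq unfolding power_mult_distrib[symmetric] y .
qed

lemma T_power_product5: "u/q * (u/q) * (s*(x1*x2*x3*x4)) = y \<Longrightarrow>
   (T n * s^n) * ((T n*x1^n) * (T n*x2^n) * (T n*x3^n) * (T n*x4^n)) = T n * y^n"
proof -
  assume y: "u/q * (u/q) * (s*(x1*x2*x3*x4)) = y"
  have "(T n * s^n) * ((T n*x1^n) * (T n*x2^n) * (T n*x3^n) * (T n*x4^n))
      = T n * ((T n * T n) * (T n * T n) * (s*(x1*x2*x3*x4))^n)"
    by (simp only: power_mult_distrib mult_ac)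
  then show ?thesis unfolding T_sq unfolding power_mult_distrib[symmetric] y .
qed

text \<open>
  How a prefactor arises. The \<open>Ai\<close> are the \<open>q\<close>-Pochhammer symbols in Watson's transformation of
  an \<open>8W7\<close> \<open>w\<close> with symmetric sum \<open>o'\<close>; multiplication by \<open>ti\<close> reflects them into the \<open>Bi\<close> that
  occur in the theorem, and \<open>m\<close> converts \<open>o'\<close> into the symmetric sum of \<open>W\<close>.
\<close>
lemma renormalise:
  fixes w :: complex
  assumes "w * (A1 * A2 * A3 * A4) = A5 * o'" "A1 * t1 = B1" "A2 * t2 = B2" "A3 * t3 = B3"
      "A4 * t4 = B4" "A5 * t5 = B5"
    "s * (t1 * t2 * t3 * t4) = t5 * m" "o1 = m * o'"
  shows "s * w * (B1 * B2 * B3 * B4) = B5 * o1"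
proof -
  have "s * w * (B1 * B2 * B3 * B4) = (w * (A1 * A2 * A3 * A4)) * (s * (t1 * t2 * t3 * t4))"
    unfolding assms(2-5)[symmetric] by (simp only: mult_ac)
  also have "\<dots> = B5 * o1" unfolding assms(1,7,8) assms(6)[symmetric] by (simp only: mult_ac)
  finally show ?thesis .
qed

text \<open>
  Sears' transformation that keeps \<open>qb/(ef)\<close> and \<open>cd/(q^n b)\<close>.
\<close>
lemma Om_pair_sears:
  "Om n b c d e f = T n * (-(q*u*b\<^sup>2/(c*d)))^n
     * cleared_phi43 n (c/(u*b)) (d/(u*b)) (q*b/(e*f)) (c*d/(u*b)) (q/(u*e)) (q/(u*f))"
proof -
  have "cleared_phi43 n (q*b/(e*f)) c d (c*d/(u*b)) (q*b/e) (q*b/f)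
     = (u*b)^n * cleared_phi43 n (q*b/(e*f)) (d/(u*b)) (c/(u*b)) (c*d/(u*b)) (q/(u*f)) (q/(u*e))"
    using sears[of "q*b/(e*f)" c d "c*d/(u*b)" "q*b/e" "q*b/f" n] nz q_nz
    by (simp add: mult_ac)
  moreover have "-(q*u*b\<^sup>2/(c*d)) = -(q*b/(c*d)) * (u*b)" by (simp add: power2_eq_square)
  ultimately show ?thesis unfolding Om_def
    by (simp only: power_mult_distrib) (metis (no_types, lifting) cleared_phi43_perm mult.assoc)
qed

text \<open>
  Sears' transformation that keeps \<open>c\<close> and \<open>cd/(q^n b)\<close>; the result distinguishes only \<open>c\<close>.
\<close>
lemma Om_single:
  "Om n b c d e f = T n * (-(q^2*u*b^3/(c^2*d*e*f)))^n
     * cleared_phi43 n (c*d*e*f/(u*q*b\<^sup>2)) (c/(u*b)) c (c*d/(u*b)) (c*e/(u*b)) (c*f/(u*b))"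
proof -
  have "cleared_phi43 n c (q*b/(e*f)) d (c*d/(u*b)) (q*b/e) (q*b/f)
     = (q*u*b^2/(c*e*f))^n * cleared_phi43 n c (c*d*e*f/(u*q*b\<^sup>2)) (c/(u*b)) (c*d/(u*b)) (c*e/(u*b))
         (c*f/(u*b))"
    using sears[of c "q*b/(e*f)" d "c*d/(u*b)" "q*b/e" "q*b/f" n] nz q_nz
    by (simp add: mult_ac power2_eq_square)
  moreover have "-(q^2*u*b^3/(c^2*d*e*f)) = -(q*b/(c*d)) * (q*u*b^2/(c*e*f))"
    by (simp add: power2_eq_square power3_eq_cube mult_ac)
  ultimately show ?thesis unfolding Om_def
    by (simp only: power_mult_distrib) (metis (no_types, lifting) cleared_phi43_perm mult.assoc)
qed

text \<open>
  Read from right to left: Sears' transformation that keeps \<open>qb/(cd)\<close> and \<open>qb/c\<close>, applied to the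
  right side, leads to \<open>Om\<close> with the pairs \<open>c, d\<close> and \<open>e, f\<close> exchanged. The series here is the
  one in \<open>Om_single\<close> summed in reverse order.
\<close>
lemma Om_single_reversed:
  "Om n b c d e f = T n * (-c)^n
     * cleared_phi43 n (q*b/(c*d)) (q*b/(c*e)) (q*b/(c*f)) (q\<^sup>2*b\<^sup>2/(c*d*e*f)) (q/(u*c)) (q*b/c)"
proof -
  have "cleared_phi43 n (q*b/(c*d)) (q*b/(c*e)) (q*b/(c*f)) (q*b/c) (q\<^sup>2*b\<^sup>2/(c*d*e*f)) (q/(u*c))
     = (q*b/(c*e*f))^n * cleared_phi43 n (q*b/(c*d)) e f (q*b/c) (e*f/(u*b)) (q*b/d)"
    using sears[of "q*b/(c*d)" "q*b/(c*e)" "q*b/(c*f)" "q*b/c" "q\<^sup>2*b\<^sup>2/(c*d*e*f)" "q/(u*c)" n] nz q_nz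
    by (simp add: mult_ac power2_eq_square)
  moreover have "-(q*b/(e*f)) = (-c) * (q*b/(c*e*f))" using nz by simp
  moreover have "Om n b c d e f = Om n b e f c d"
    using Om_swap Om_swap_outer nz by metis
  ultimately show ?thesis unfolding Om_def[of _ _ e f]
    by (simp only: power_mult_distrib) (metis (no_types, lifting) cleared_phi43_perm mult.assoc)
qed

end

section \<open>The ten expressions\<close>

locale very_well_poised = parameters +
  assumes ok: "W87_ok b n c d e f q"
begin

abbreviation W where "W \<equiv> W87 b n c d e f q (q ^ (n + 2) * b\<^sup>2 / (c * d * e * f))"

lemma W_Om: "W * (P (q*b/c) n * P (q*b/d) n * P (q*b/e) n * P (q*b/f) n) = P (q*b) n * Om n b c d e f"
  by (rule watson[OF nz ok])

lemma powi_simps: "q powi (- int n) = 1/u" "q powi (- int n - 1) = 1/(u*q)" "q powi (1 - int n) = q/u"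
   "q powi (- 2 * int n) = 1/(u*u)" "q powi (- 2 * int n - 1) = 1/(u*u*q)"
proof -
  have 1: "q powi (- int n) = 1/u" by (simp add: power_int_minus inverse_eq_divide)
  have "- 2 * int n = - int (n + n)" by simp
  then have 2: "q powi (- 2 * int n) = 1/(u*u)"
    by (simp only: power_int_minus power_int_of_nat power_add inverse_eq_divide)
  have d: "q powi (k - 1) = q powi k / q" for k using q_nz by (simp add: power_int_diff)
  have "q powi (1 - int n) = q powi 1 / q powi int n" by (rule power_int_diff) (simp add: q_nz)
  then show "q powi (1 - int n) = q/u" by simp
  show "q powi (- int n) = 1/u" "q powi (- 2 * int n) = 1/(u*u)" by fact+
  show "q powi (- int n - 1) = 1/(u*q)" "q powi (- 2 * int n - 1) = 1/(u*u*q)"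
    unfolding d 1 2 by simp_all
qed

text \<open>
  Watson's transformation of the right side, with \<open>c/(q^n b)\<close> and \<open>d/(q^n b)\<close> as the
  distinguished pair, yields the series in \<open>Om_pair_sears\<close>. The two \<open>8W7\<close> are each other's
  reversal.
\<close>
lemma W87_reversed:
  assumes "qpoch b q (2 * n) * qpochs [q * b / c, q * b / d, q * b / e, q * b / f] q n \<noteq> 0 \<and>
     W87_ok (q powi (- 2 * int n) / b) n (q powi (- int n) * c / b) (q powi (- int n) * d / b)
       (q powi (- int n) * e / b) (q powi (- int n) * f / b) q"
  shows "W = q ^ (n choose 2) * (- (q\<^sup>2) * b\<^sup>2 / (c * d * e * f)) ^ n
         * (qpochs [q * b, b, c, d, e, f] q n
            / (qpoch b q (2 * n) * qpochs [q * b / c, q * b / d, q * b / e, q * b / f] q n))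
         * W87 (q powi (- 2 * int n) / b) n (q powi (- int n) * c / b) (q powi (- int n) * d / b)
             (q powi (- int n) * e / b) (q powi (- int n) * f / b) q
             (q ^ (n + 2) * b\<^sup>2 / (c * d * e * f))"
proof -
  \<comment> \<open>primed letters are the base and the parameters of the \<open>8W7\<close> on the right\<close>
  define b' c' d' e' f' where defs: "b' = 1/(u*u)/b" "c' = 1/u*c/b" "d' = 1/u*d/b" "e' = 1/u*e/b"
      "f' = 1/u*f/b"
  have nz': "b' \<noteq> 0" "c' \<noteq> 0" "d' \<noteq> 0" "e' \<noteq> 0" "f' \<noteq> 0" using nz q_nz by (simp_all add: defs)
  have ok': "W87_ok b' n c' d' e' f' q" using assms unfolding powi_simps defs by simp
  define z where z: "z = q ^ (n + 2) * b\<^sup>2 / (c * d * e * f)"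
  have z': "q ^ (n + 2) * b'\<^sup>2 / (c' * d' * e' * f') = z"
    using nz q_nz by (simp add: z defs power2_eq_square)
  define s where s: "s = - (q\<^sup>2) * b\<^sup>2 / (c * d * e * f)"
  have r: "P (q*b'/c') n * (T n * (-c)^n) = P c n" "P (q*b'/d') n * (T n * (-d)^n) = P d n"
     "P (q*b'/e') n * (T n * (-e)^n) = P e n" "P (q*b'/f') n * (T n * (-f)^n) = P f n"
     "P (q*b') n * (T n * (-(u*b))^n) = P (u*b) n"
    by (rule reflect; use nz q_nz in \<open>simp add: defs\<close>)+
  have "Om n b' c' d' e' f' = T n * (-(q*b/(c*d)))^n
     * cleared_phi43 n (q*b/(e*f)) c' d' (c*d/(u*b)) (q/(u*e)) (q/(u*f))"
  proof -
    have "q*b'/(c'*d') = q*b/(c*d)" "q*b'/(e'*f') = q*b/(e*f)" "c'*d'/(u*b') = c*d/(u*b)"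
      "q*b'/e' = q/(u*e)" "q*b'/f' = q/(u*f)" using nz q_nz by (simp_all add: defs)
    then show ?thesis unfolding Om_def by simp
  qed
  moreover have "Om n b c d e f = T n * (-(q*u*b\<^sup>2/(c*d)))^n
     * cleared_phi43 n (q*b/(e*f)) c' d' (c*d/(u*b)) (q/(u*e)) (q/(u*f))"
    unfolding Om_pair_sears defs by (metis (no_types, lifting) cleared_phi43_perm mult_1
        times_divide_eq_left divide_divide_eq_left)
  moreover have "-(q*u*b\<^sup>2/(c*d)) = -(q*b/(c*d)) * (u*b)" by (simp add: power2_eq_square)
  ultimately have Om: "Om n b c d e f = (u*b)^n * Om n b' c' d' e' f'"
    by (simp only: power_mult_distrib mult_ac)
  have m: "(T n * s^n) * ((T n*(-c)^n) * (T n*(-d)^n) * (T n*(-e)^n) * (T n*(-f)^n))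
      = T n * (-(u*b)*(u*b))^n"
    by (rule T_power_product5) (use nz q_nz in \<open>simp add: s power2_eq_square\<close>)
  have w: "W87 b' n c' d' e' f' q z * (P (q*b'/c') n * P (q*b'/d') n * P (q*b'/e') n * P (q*b'/f') n)
      = P (q*b') n * Om n b' c' d' e' f'"
    using watson[OF nz' ok'] unfolding z' .
  have main: "(T n * s^n) * W87 b' n c' d' e' f' q z * (P c n * P d n * P e n * P f n)
      = P (u*b) n * Om n b c d e f"
    by (rule renormalise[OF w r _ Om]) (subst m, simp only: power_mult_distrib mult_ac)
  have P2: "P b (2*n) = P b n * P (u*b) n" unfolding mult_2 qpoch_add by (simp add: mult_ac)
  have nzs: "P b n \<noteq> 0" "P (u*b) n \<noteq> 0" "P (q*b/c) n \<noteq> 0" "P (q*b/d) n \<noteq> 0" "P (q*b/e) n \<noteq> 0"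
      "P (q*b/f) n \<noteq> 0"
    using assms unfolding P2 qpochs_def by auto
  have "W = P (q*b) n * (P (u*b) n * Om n b c d e f) / (P (u*b) n * (P (q*b/c) n * P (q*b/d) n
      * P (q*b/e) n * P (q*b/f) n))"
    using W_Om nzs by (simp add: nonzero_eq_divide_eq mult_ac)
  then show ?thesis unfolding main[unfolded defs z s, symmetric] P2 qpochs_def powi_simps
    using nzs by (simp add: mult_ac)
qed

text \<open>
  With \<open>c\<close> and \<open>qb/(de)\<close> as the distinguished pair on the right, both sides lead to the same
  \<open>4\<phi>3\<close> as \<open>Om\<close> with the pairs \<open>c, f\<close> and \<open>d, e\<close>.
\<close>
lemma W87_base_c_over_d:
  assumes "qpochs [q * b / c, q * b / e, q * b / f, d / c] q n \<noteq> 0 \<and>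
     W87_ok (q powi (- int n) * c / d) n (q powi (- int n) * c / b) (q * b / (d * e))
       (q * b / (d * f)) c q"
  shows "W = qpochs [q * b / (c * e), q * b / (c * f), q * b, d] q n
         / qpochs [q * b / c, q * b / e, q * b / f, d / c] q n
         * W87 (q powi (- int n) * c / d) n (q powi (- int n) * c / b) (q * b / (d * e))
             (q * b / (d * f)) c q (e * f / b)"
proof -
  define b' c' d' e' f' where defs: "b' = 1/u*c/d" "c' = 1/u*c/b" "d' = q*b/(d*e)" "e' = q*b/(d*f)" "f' = c"
  have nz': "b' \<noteq> 0" "c' \<noteq> 0" "d' \<noteq> 0" "e' \<noteq> 0" "f' \<noteq> 0" using nz q_nz by (simp_all add: defs)
  have ok': "W87_ok b' n c' d' e' f' q" using assms unfolding powi_simps defs by simp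
  define z where z: "z = e * f / b"
  have z': "q ^ (n + 2) * b'\<^sup>2 / (c' * d' * e' * f') = z"
    using nz q_nz by (simp add: z defs power2_eq_square mult_ac)
  have Om: "Om n b c d e f = (q*u*b\<^sup>2/(c*e*f))^n * Om n b' c' d' e' f'"
  proof -
    have a: "q*b'/(f'*d') = e/(u*b)" "q*b'/(c'*e') = f" "f'*d'/(u*b') = q*b/e" "q*b'/c' = q*b/d"
        "q*b'/e' = c*f/(u*b)"
      using nz q_nz by (simp_all add: defs)
    have "Om n b' c' d' e' f' = Om n b' f' d' c' e'" by (rule Om_perms[OF nz'])
    also have "\<dots> = T n * (-(e/(u*b)))^n * cleared_phi43 n f f' d' (q*b/e) (q*b/d) (c*f/(u*b))"
      unfolding Om_def a ..
    also have "\<dots> = T n * (-(e/(u*b)))^n * cleared_phi43 n (q*b/(d*e)) c f (c*f/(u*b)) (q*b/d) (q*b/e)"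
      unfolding defs by (metis cleared_phi43_perm)
    finally have 1: "Om n b' c' d' e' f' = \<dots>" .
    have "Om n b c d e f = Om n b c f d e" by (rule Om_perms[OF nz])
    then have 2: "Om n b c d e f = T n * (-(q*b/(c*f)))^n
        * cleared_phi43 n (q*b/(d*e)) c f (c*f/(u*b)) (q*b/d) (q*b/e)"
      unfolding Om_def .
    have 3: "-(q*b/(c*f)) = (q*u*b\<^sup>2/(c*e*f)) * -(e/(u*b))" using nz q_nz
        by (simp add: power2_eq_square mult_ac)
    show ?thesis unfolding 1 2 unfolding 3 by (simp only: power_mult_distrib mult_ac)
  qed
  have r: "P (q*b'/c') n * 1 = P (q*b/d) n"
    "P (q*b'/d') n * (T n * (-(q*b/(c*e)))^n) = P (q*b/(c*e)) n"
    "P (q*b'/e') n * (T n * (-(q*b/(c*f)))^n) = P (q*b/(c*f)) n"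
    "P (q*b'/f') n * (T n * (-(d))^n) = P (d) n"
    "P (q*b') n * (T n * (-(d/c))^n) = P (d/c) n"
  proof -
    have "q*b'/c' = q*b/d" using nz q_nz by (simp add: defs power2_eq_square mult_ac)
    then show "P (q*b'/c') n * 1 = P (q*b/d) n" by simp
    show "P (q*b'/d') n * (T n * (-(q*b/(c*e)))^n) = P (q*b/(c*e)) n"
      by (rule reflect) (use nz q_nz in \<open>simp_all add: defs power2_eq_square mult_ac\<close>)
    show "P (q*b'/e') n * (T n * (-(q*b/(c*f)))^n) = P (q*b/(c*f)) n"
      by (rule reflect) (use nz q_nz in \<open>simp_all add: defs power2_eq_square mult_ac\<close>)
    show "P (q*b'/f') n * (T n * (-(d))^n) = P (d) n"
      by (rule reflect) (use nz q_nz in \<open>simp_all add: defs power2_eq_square mult_ac\<close>)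
    show "P (q*b') n * (T n * (-(d/c))^n) = P (d/c) n"
      by (rule reflect) (use nz q_nz in \<open>simp_all add: defs power2_eq_square mult_ac\<close>)
  qed
  have w: "W87 b' n c' d' e' f' q z * (P (q*b'/c') n * P (q*b'/d') n * P (q*b'/e') n * P (q*b'/f') n)
      = P (q*b') n * Om n b' c' d' e' f'"
    using watson[OF nz' ok'] unfolding z' .
  have m: "(T n*(-(q*b/(c*e)))^n) * (T n*(-(q*b/(c*f)))^n) * (T n*(-d)^n)
      = T n * (-(d/c) * (q*u*b\<^sup>2/(c*e*f)))^n"
    by (rule T_power_product3) (use nz q_nz in \<open>simp add: power2_eq_square mult_ac\<close>)
  have main: "1 * W87 b' n c' d' e' f' q z * (P (q*b/d) n * P (q*b/(c*e)) n * P (q*b/(c*f)) n * P (d) n)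
      = P (d/c) n * Om n b c d e f"
    by (rule renormalise[OF w r _ Om]) (use m in \<open>simp only: mult_1_left mult_1_right power_mult_distrib
        mult_ac\<close>)
  have nzs: "P (q*b/c) n \<noteq> 0" "P (q*b/d) n \<noteq> 0" "P (q*b/e) n \<noteq> 0" "P (q*b/f) n \<noteq> 0" "P (d/c) n \<noteq> 0"
    using assms W87_okD[OF ok] unfolding qpochs_def by auto
  have "W = P (q*b) n * (P (d/c) n * Om n b c d e f) / (P (d/c) n * (P (q*b/c) n * P (q*b/d) n
      * P (q*b/e) n * P (q*b/f) n))"
    using W_Om nzs by (simp add: nonzero_eq_divide_eq mult_ac)
  then show ?thesis unfolding main[unfolded defs z, symmetric] qpochs_def powi_simps
    using nzs by (simp add: mult_ac)
qed

text \<open>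
  With \<open>d\<close> and \<open>e\<close> as the distinguished pair on both sides, the \<open>4\<phi>3\<close> coincide.
\<close>
lemma W87_base_def_over_b:
  assumes "qpochs [q * b / (d * e * f), q * b / d, q * b / e, q * b / f] q n \<noteq> 0 \<and>
     W87_ok (q powi (- int n - 1) * d * e * f / b) n d e f
       (q powi (- int n - 1) * c * d * e * f / b\<^sup>2) q"
  shows "W = qpochs [q * b / (d * e), q * b / (d * f), q * b / (e * f), q * b] q n
         / qpochs [q * b / (d * e * f), q * b / d, q * b / e, q * b / f] q n
         * W87 (q powi (- int n - 1) * d * e * f / b) n d e f
             (q powi (- int n - 1) * c * d * e * f / b\<^sup>2) q (q / c)"
proof -
  define b' c' d' e' f' where defs: "b' = 1/(u*q)*d*e*f/b" "c' = d" "d' = e" "e' = f"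
      "f' = 1/(u*q)*c*d*e*f/b\<^sup>2"
  have nz': "b' \<noteq> 0" "c' \<noteq> 0" "d' \<noteq> 0" "e' \<noteq> 0" "f' \<noteq> 0" using nz q_nz by (simp_all add: defs)
  have ok': "W87_ok b' n c' d' e' f' q" using assms unfolding powi_simps defs by simp
  define z where z: "z = q / c"
  have z': "q ^ (n + 2) * b'\<^sup>2 / (c' * d' * e' * f') = z"
    using nz q_nz by (simp add: z defs power2_eq_square mult_ac)
  have Om: "Om n b c d e f = (q*u*b\<^sup>2/(d*e*f))^n * Om n b' c' d' e' f'"
  proof -
    have a: "q*b'/(c'*d') = f/(u*b)" "q*b'/(e'*f') = q*b/(c*f)" "c'*d'/(u*b') = q*b/f"
        "q*b'/e' = d*e/(u*b)" "q*b'/f' = q*b/c"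
      using nz q_nz by (simp_all add: defs power2_eq_square mult_ac)
    have "Om n b' c' d' e' f' = T n * (-(f/(u*b)))^n
        * cleared_phi43 n (q*b/(c*f)) c' d' (q*b/f) (d*e/(u*b)) (q*b/c)"
      unfolding Om_def a ..
    also have "\<dots> = T n * (-(f/(u*b)))^n * cleared_phi43 n (q*b/(c*f)) d e (d*e/(u*b)) (q*b/c) (q*b/f)"
      unfolding defs by (metis cleared_phi43_perm)
    finally have 1: "Om n b' c' d' e' f' = \<dots>" .
    have "Om n b c d e f = Om n b d e c f" by (rule Om_perms[OF nz])
    then have 2: "Om n b c d e f = T n * (-(q*b/(d*e)))^n
        * cleared_phi43 n (q*b/(c*f)) d e (d*e/(u*b)) (q*b/c) (q*b/f)"
      unfolding Om_def .
    have 3: "-(q*b/(d*e)) = (q*u*b\<^sup>2/(d*e*f)) * -(f/(u*b))" using nz q_nz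
        by (simp add: power2_eq_square mult_ac)
    show ?thesis unfolding 1 2 unfolding 3 by (simp only: power_mult_distrib mult_ac)
  qed
  have r: "P (q*b'/c') n * (T n * (-(q*b/(e*f)))^n) = P (q*b/(e*f)) n"
    "P (q*b'/d') n * (T n * (-(q*b/(d*f)))^n) = P (q*b/(d*f)) n"
    "P (q*b'/e') n * (T n * (-(q*b/(d*e)))^n) = P (q*b/(d*e)) n"
    "P (q*b'/f') n * 1 = P (q*b/c) n"
    "P (q*b') n * (T n * (-(q*b/(d*e*f)))^n) = P (q*b/(d*e*f)) n"
  proof -
    show "P (q*b'/c') n * (T n * (-(q*b/(e*f)))^n) = P (q*b/(e*f)) n"
      by (rule reflect) (use nz q_nz in \<open>simp_all add: defs power2_eq_square mult_ac\<close>)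
    show "P (q*b'/d') n * (T n * (-(q*b/(d*f)))^n) = P (q*b/(d*f)) n"
      by (rule reflect) (use nz q_nz in \<open>simp_all add: defs power2_eq_square mult_ac\<close>)
    show "P (q*b'/e') n * (T n * (-(q*b/(d*e)))^n) = P (q*b/(d*e)) n"
      by (rule reflect) (use nz q_nz in \<open>simp_all add: defs power2_eq_square mult_ac\<close>)
    have "q*b'/f' = q*b/c" using nz q_nz by (simp add: defs power2_eq_square mult_ac)
    then show "P (q*b'/f') n * 1 = P (q*b/c) n" by simp
    show "P (q*b') n * (T n * (-(q*b/(d*e*f)))^n) = P (q*b/(d*e*f)) n"
      by (rule reflect) (use nz q_nz in \<open>simp_all add: defs power2_eq_square mult_ac\<close>)
  qed
  have w: "W87 b' n c' d' e' f' q z * (P (q*b'/c') n * P (q*b'/d') n * P (q*b'/e') n * P (q*b'/f') n)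
      = P (q*b') n * Om n b' c' d' e' f'"
    using watson[OF nz' ok'] unfolding z' .
  have m: "(T n*(-(q*b/(e*f)))^n) * (T n*(-(q*b/(d*f)))^n) * (T n*(-(q*b/(d*e)))^n)
      = T n * (-(q*b/(d*e*f)) * (q*u*b\<^sup>2/(d*e*f)))^n"
    by (rule T_power_product3) (use nz q_nz in \<open>simp add: power2_eq_square mult_ac\<close>)
  have main: "1 * W87 b' n c' d' e' f' q z * (P (q*b/(e*f)) n * P (q*b/(d*f)) n * P (q*b/(d*e)) n
      * P (q*b/c) n) = P (q*b/(d*e*f)) n * Om n b c d e f"
    by (rule renormalise[OF w r _ Om]) (use m in \<open>simp only: mult_1_left mult_1_right power_mult_distrib
        mult_ac\<close>)
  have nzs: "P (q*b/c) n \<noteq> 0" "P (q*b/d) n \<noteq> 0" "P (q*b/e) n \<noteq> 0" "P (q*b/f) n \<noteq> 0" "P (q*b/(d*e*f)) n \<noteq> 0"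
    using assms W87_okD[OF ok] unfolding qpochs_def by auto
  have "W = P (q*b) n * (P (q*b/(d*e*f)) n * Om n b c d e f) / (P (q*b/(d*e*f)) n * (P (q*b/c) n
      * P (q*b/d) n * P (q*b/e) n * P (q*b/f) n))"
    using W_Om nzs by (simp add: nonzero_eq_divide_eq mult_ac)
  then show ?thesis unfolding main[unfolded defs z, symmetric] qpochs_def powi_simps
    using nzs by (simp add: mult_ac)
qed

text \<open>
  With \<open>qb/(de)\<close> and \<open>qb/(df)\<close> as the distinguished pair on the right, the \<open>4\<phi>3\<close> is the one in
  \<open>Om_single_reversed\<close> with \<open>d\<close> in the role of \<open>c\<close>.
\<close>
lemma W87_base_b_over_def:
  assumes "qpochs [d * e * f / (q * b), q * b / c, q * b / d, q * b / e, q * b / f] q n \<noteq> 0 \<and>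
     W87_ok (q powi (1 - int n) * b / (d * e * f)) n (q powi (- int n) * c / b)
       (q * b / (d * e)) (q * b / (d * f)) (q * b / (e * f)) q"
  shows "W = qpochs [q\<^sup>2 * b\<^sup>2 / (c * d * e * f), q * b, d, e, f] q n
         / qpochs [d * e * f / (q * b), q * b / c, q * b / d, q * b / e, q * b / f] q n
         * W87 (q powi (1 - int n) * b / (d * e * f)) n (q powi (- int n) * c / b)
             (q * b / (d * e)) (q * b / (d * f)) (q * b / (e * f)) q (q / c)"
proof -
  define b' c' d' e' f' where defs: "b' = q/u*b/(d*e*f)" "c' = 1/u*c/b" "d' = q*b/(d*e)"
      "e' = q*b/(d*f)" "f' = q*b/(e*f)"
  have nz': "b' \<noteq> 0" "c' \<noteq> 0" "d' \<noteq> 0" "e' \<noteq> 0" "f' \<noteq> 0" using nz q_nz by (simp_all add: defs)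
  have ok': "W87_ok b' n c' d' e' f' q" using assms unfolding powi_simps defs by simp
  define z where z: "z = q / c"
  have z': "q ^ (n + 2) * b'\<^sup>2 / (c' * d' * e' * f') = z"
    using nz q_nz by (simp add: z defs power2_eq_square mult_ac)
  have Om: "Om n b c d e f = (u*b)^n * Om n b' c' d' e' f'"
  proof -
    have a: "q*b'/(d'*e') = d/(u*b)" "q*b'/(c'*f') = q*b/(c*d)" "d'*e'/(u*b') = q*b/d"
        "q*b'/c' = q\<^sup>2*b\<^sup>2/(c*d*e*f)" "q*b'/f' = q/(u*d)"
      using nz q_nz by (simp_all add: defs power2_eq_square mult_ac)
    have "Om n b' c' d' e' f' = Om n b' d' e' c' f'" by (rule Om_perms[OF nz'])
    also have "\<dots> = T n * (-(d/(u*b)))^n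
        * cleared_phi43 n (q*b/(c*d)) d' e' (q*b/d) (q\<^sup>2*b\<^sup>2/(c*d*e*f)) (q/(u*d))"
      unfolding Om_def a ..
    also have "\<dots> = T n * (-(d/(u*b)))^n
        * cleared_phi43 n (q*b/(c*d)) (q*b/(d*e)) (q*b/(d*f)) (q\<^sup>2*b\<^sup>2/(c*d*e*f)) (q/(u*d)) (q*b/d)"
      unfolding defs by (metis cleared_phi43_perm)
    finally have 1: "Om n b' c' d' e' f' = \<dots>" .
    interpret dc: parameters q n b d c e f by unfold_locales (use nz in auto)
    have "Om n b c d e f = Om n b d c e f" by (rule Om_perms[OF nz])
    then have 2: "Om n b c d e f = T n * (-d)^n
        * cleared_phi43 n (q*b/(c*d)) (q*b/(d*e)) (q*b/(d*f)) (q\<^sup>2*b\<^sup>2/(c*d*e*f)) (q/(u*d)) (q*b/d)"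
      unfolding dc.Om_single_reversed by (simp only: mult.commute[of d c])
    have 3: "-d = (u*b) * -(d/(u*b))" using nz q_nz by simp
    show ?thesis unfolding 1 2 by (subst 3) (simp only: power_mult_distrib mult_ac)
  qed
  have r: "P (q*b'/c') n * 1 = P (q\<^sup>2*b\<^sup>2/(c*d*e*f)) n"
    "P (q*b'/d') n * (T n * (-(f))^n) = P (f) n"
    "P (q*b'/e') n * (T n * (-(e))^n) = P (e) n"
    "P (q*b'/f') n * (T n * (-(d))^n) = P (d) n"
    "P (q*b') n * (T n * (-(d*e*f/(q*b)))^n) = P (d*e*f/(q*b)) n"
  proof -
    have "q*b'/c' = q\<^sup>2*b\<^sup>2/(c*d*e*f)" using nz q_nz by (simp add: defs power2_eq_square mult_ac)
    then show "P (q*b'/c') n * 1 = P (q\<^sup>2*b\<^sup>2/(c*d*e*f)) n" by simp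
    show "P (q*b'/d') n * (T n * (-(f))^n) = P (f) n"
      by (rule reflect) (use nz q_nz in \<open>simp_all add: defs power2_eq_square mult_ac\<close>)
    show "P (q*b'/e') n * (T n * (-(e))^n) = P (e) n"
      by (rule reflect) (use nz q_nz in \<open>simp_all add: defs power2_eq_square mult_ac\<close>)
    show "P (q*b'/f') n * (T n * (-(d))^n) = P (d) n"
      by (rule reflect) (use nz q_nz in \<open>simp_all add: defs power2_eq_square mult_ac\<close>)
    show "P (q*b') n * (T n * (-(d*e*f/(q*b)))^n) = P (d*e*f/(q*b)) n"
      by (rule reflect) (use nz q_nz in \<open>simp_all add: defs power2_eq_square mult_ac\<close>)
  qed
  have w: "W87 b' n c' d' e' f' q z * (P (q*b'/c') n * P (q*b'/d') n * P (q*b'/e') n * P (q*b'/f') n)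
      = P (q*b') n * Om n b' c' d' e' f'"
    using watson[OF nz' ok'] unfolding z' .
  have m: "(T n*(-f)^n) * (T n*(-e)^n) * (T n*(-d)^n) = T n * (-(d*e*f/(q*b)) * (u*b))^n"
    by (rule T_power_product3) (use nz q_nz in simp)
  have main: "1 * W87 b' n c' d' e' f' q z * (P (q\<^sup>2*b\<^sup>2/(c*d*e*f)) n * P (f) n * P (e) n * P (d) n)
      = P (d*e*f/(q*b)) n * Om n b c d e f"
    by (rule renormalise[OF w r _ Om]) (use m in \<open>simp only: mult_1_left mult_1_right power_mult_distrib
        mult_ac\<close>)
  have nzs: "P (q*b/c) n \<noteq> 0" "P (q*b/d) n \<noteq> 0" "P (q*b/e) n \<noteq> 0" "P (q*b/f) n \<noteq> 0" "P (d*e*f/(q*b)) n \<noteq> 0"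
    using assms W87_okD[OF ok] unfolding qpochs_def by auto
  have "W = P (q*b) n * (P (d*e*f/(q*b)) n * Om n b c d e f) / (P (d*e*f/(q*b)) n * (P (q*b/c) n
      * P (q*b/d) n * P (q*b/e) n * P (q*b/f) n))"
    using W_Om nzs by (simp add: nonzero_eq_divide_eq mult_ac)
  then show ?thesis unfolding main[unfolded defs z, symmetric] qpochs_def powi_simps
    using nzs by (simp add: mult_ac)
qed

text \<open>
  With \<open>c\<close> and \<open>qb/(de)\<close> as the distinguished pair on the right, the \<open>4\<phi>3\<close> is the one in \<open>Om\<close>
  with the pairs \<open>c, f\<close> and \<open>d, e\<close>. The powers in front agree as well, so the two symmetric sums
  are equal.
\<close>
lemma W87_base_b2_over_def:
  assumes "qpochs [q * b / c, q\<^sup>2 * b\<^sup>2 / (d * e * f)] q n \<noteq> 0 \<and>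
     W87_ok (q * b\<^sup>2 / (d * e * f)) n (q * b / (d * e)) (q * b / (d * f)) (q * b / (e * f)) c q"
  shows "W = qpochs [q\<^sup>2 * b\<^sup>2 / (c * d * e * f), q * b] q n
         / qpochs [q * b / c, q\<^sup>2 * b\<^sup>2 / (d * e * f)] q n
         * W87 (q * b\<^sup>2 / (d * e * f)) n (q * b / (d * e)) (q * b / (d * f)) (q * b / (e * f)) c q
             (q ^ (n + 1) * b / c)"
proof -
  define b' c' d' e' f' where defs: "b' = q*b\<^sup>2/(d*e*f)" "c' = q*b/(d*e)" "d' = q*b/(d*f)"
      "e' = q*b/(e*f)" "f' = c"
  have nz': "b' \<noteq> 0" "c' \<noteq> 0" "d' \<noteq> 0" "e' \<noteq> 0" "f' \<noteq> 0" using nz q_nz by (simp_all add: defs)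
  have ok': "W87_ok b' n c' d' e' f' q" using assms unfolding powi_simps defs by simp
  define z where z: "z = q ^ (n + 1) * b / c"
  have z': "q ^ (n + 2) * b'\<^sup>2 / (c' * d' * e' * f') = z"
    using nz q_nz by (simp add: z defs power2_eq_square mult_ac)
  have Om: "Om n b c d e f = 1 * Om n b' c' d' e' f'"
  proof -
    have a: "q*b'/(f'*c') = q*b/(c*f)" "q*b'/(d'*e') = f" "f'*c'/(u*b') = c*f/(u*b)" "q*b'/d' = q*b/e"
        "q*b'/e' = q*b/d"
      using nz q_nz by (simp_all add: defs power2_eq_square mult_ac)
    have "Om n b' c' d' e' f' = Om n b' f' c' d' e'" by (rule Om_perms[OF nz'])
    also have "\<dots> = T n * (-(q*b/(c*f)))^n * cleared_phi43 n f f' c' (c*f/(u*b)) (q*b/e) (q*b/d)"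
      unfolding Om_def a ..
    also have "\<dots> = T n * (-(q*b/(c*f)))^n * cleared_phi43 n (q*b/(d*e)) c f (c*f/(u*b)) (q*b/d) (q*b/e)"
      unfolding defs by (metis cleared_phi43_perm)
    also have "\<dots> = Om n b c f d e" unfolding Om_def ..
    also have "\<dots> = Om n b c d e f" by (rule Om_perms(1)[OF nz, symmetric])
    finally show ?thesis by simp
  qed
  have r: "P (q*b'/c') n * 1 = P (q*b/f) n"
    "P (q*b'/d') n * 1 = P (q*b/e) n"
    "P (q*b'/e') n * 1 = P (q*b/d) n"
    "P (q*b'/f') n * 1 = P (q\<^sup>2*b\<^sup>2/(c*d*e*f)) n"
    "P (q*b') n * 1 = P (q\<^sup>2*b\<^sup>2/(d*e*f)) n"
  proof -
    have "q*b'/c' = q*b/f" using nz q_nz by (simp add: defs power2_eq_square mult_ac)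
    then show "P (q*b'/c') n * 1 = P (q*b/f) n" by simp
    have "q*b'/d' = q*b/e" using nz q_nz by (simp add: defs power2_eq_square mult_ac)
    then show "P (q*b'/d') n * 1 = P (q*b/e) n" by simp
    have "q*b'/e' = q*b/d" using nz q_nz by (simp add: defs power2_eq_square mult_ac)
    then show "P (q*b'/e') n * 1 = P (q*b/d) n" by simp
    have "q*b'/f' = q\<^sup>2*b\<^sup>2/(c*d*e*f)" using nz q_nz by (simp add: defs power2_eq_square mult_ac)
    then show "P (q*b'/f') n * 1 = P (q\<^sup>2*b\<^sup>2/(c*d*e*f)) n" by simp
    have "q*b' = q\<^sup>2*b\<^sup>2/(d*e*f)" using nz q_nz by (simp add: defs power2_eq_square mult_ac)
    then show "P (q*b') n * 1 = P (q\<^sup>2*b\<^sup>2/(d*e*f)) n" by simp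
  qed
  have w: "W87 b' n c' d' e' f' q z * (P (q*b'/c') n * P (q*b'/d') n * P (q*b'/e') n * P (q*b'/f') n)
      = P (q*b') n * Om n b' c' d' e' f'"
    using watson[OF nz' ok'] unfolding z' .
  have main: "1 * W87 b' n c' d' e' f' q z * (P (q*b/f) n * P (q*b/e) n * P (q*b/d) n
      * P (q\<^sup>2*b\<^sup>2/(c*d*e*f)) n) = P (q\<^sup>2*b\<^sup>2/(d*e*f)) n * Om n b c d e f"
    by (rule renormalise[OF w r _ Om]) simp
  have nzs: "P (q*b/c) n \<noteq> 0" "P (q*b/d) n \<noteq> 0" "P (q*b/e) n \<noteq> 0" "P (q*b/f) n \<noteq> 0"
      "P (q\<^sup>2*b\<^sup>2/(d*e*f)) n \<noteq> 0"
    using assms W87_okD[OF ok] unfolding qpochs_def by auto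
  have "W = P (q*b) n * (P (q\<^sup>2*b\<^sup>2/(d*e*f)) n * Om n b c d e f) / (P (q\<^sup>2*b\<^sup>2/(d*e*f)) n * (P (q*b/c) n
      * P (q*b/d) n * P (q*b/e) n * P (q*b/f) n))"
    using W_Om nzs by (simp add: nonzero_eq_divide_eq mult_ac)
  then show ?thesis unfolding main[unfolded defs z, symmetric] qpochs_def powi_simps
    using nzs by (simp add: mult_ac)
qed

text \<open>
  With \<open>d/(q^n b)\<close> and \<open>e/(q^n b)\<close> as the distinguished pair on the right, the \<open>4\<phi>3\<close> is the one
  in \<open>Om_pair_sears\<close> with the pairs \<open>d, e\<close> and \<open>c, f\<close>.
\<close>
lemma W87_base_def_over_b2:
  assumes "qpoch (q * b\<^sup>2 / (d * e * f)) q (2 * n)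
       * qpochs [q * b / c, q * b / d, q * b / e, q * b / f] q n \<noteq> 0 \<and>
     W87_ok (q powi (- 2 * int n - 1) * d * e * f / b\<^sup>2) n (q powi (- int n) * d / b)
       (q powi (- int n) * e / b) (q powi (- int n) * f / b)
       (q powi (- int n - 1) * c * d * e * f / b\<^sup>2) q"
  shows "W = q ^ (n choose 2) * (- (q * b / c)) ^ n
         * (qpochs [q * b\<^sup>2 / (d * e * f), q * b / (e * f), q * b / (d * e), q * b / (d * f),
              q * b, c] q n
            / (qpoch (q * b\<^sup>2 / (d * e * f)) q (2 * n)
               * qpochs [q * b / c, q * b / d, q * b / e, q * b / f] q n))
         * W87 (q powi (- 2 * int n - 1) * d * e * f / b\<^sup>2) n (q powi (- int n) * d / b)
             (q powi (- int n) * e / b) (q powi (- int n) * f / b)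
             (q powi (- int n - 1) * c * d * e * f / b\<^sup>2) q (q ^ (n + 1) * b / c)"
proof -
  define b' c' d' e' f' where defs: "b' = 1/(u*u*q)*d*e*f/b\<^sup>2" "c' = 1/u*d/b" "d' = 1/u*e/b"
      "e' = 1/u*f/b" "f' = 1/(u*q)*c*d*e*f/b\<^sup>2"
  have nz': "b' \<noteq> 0" "c' \<noteq> 0" "d' \<noteq> 0" "e' \<noteq> 0" "f' \<noteq> 0" using nz q_nz by (simp_all add: defs)
  have ok': "W87_ok b' n c' d' e' f' q" using assms unfolding powi_simps defs by simp
  define z where z: "z = q ^ (n + 1) * b / c"
  have z': "q ^ (n + 2) * b'\<^sup>2 / (c' * d' * e' * f') = z"
    using nz q_nz by (simp add: z defs power2_eq_square mult_ac)
  define s where s: "s = - (q*b/c)"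
  have Om: "Om n b c d e f = (q*u*b\<^sup>2/(d*e*f))^n * Om n b' c' d' e' f'"
  proof -
    have a: "q*b'/(c'*d') = f" "q*b'/(e'*f') = q*b/(c*f)" "c'*d'/(u*b') = q/(u*f)" "q*b'/e' = d*e/(u*b)"
        "q*b'/f' = q/(u*c)"
      "c' = d/(u*b)" "d' = e/(u*b)"
      using nz q_nz by (simp_all add: defs power2_eq_square mult_ac)
    have "Om n b' c' d' e' f' = T n * (-f)^n
        * cleared_phi43 n (q*b/(c*f)) c' d' (q/(u*f)) (d*e/(u*b)) (q/(u*c))"
      unfolding Om_def a(1-5) ..
    also have "\<dots> = T n * (-f)^n * cleared_phi43 n (d/(u*b)) (e/(u*b)) (q*b/(c*f)) (d*e/(u*b)) (q/(u*c))
        (q/(u*f))"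
      unfolding a(6,7) by (metis cleared_phi43_perm)
    finally have 1: "Om n b' c' d' e' f' = \<dots>" .
    interpret de: parameters q n b d e c f by unfold_locales (use nz in auto)
    have "Om n b c d e f = Om n b d e c f" by (rule Om_perms[OF nz])
    then have 2: "Om n b c d e f = T n * (-(q*u*b\<^sup>2/(d*e)))^n
        * cleared_phi43 n (d/(u*b)) (e/(u*b)) (q*b/(c*f)) (d*e/(u*b)) (q/(u*c)) (q/(u*f))"
      unfolding de.Om_pair_sears .
    have 3: "-(q*u*b\<^sup>2/(d*e)) = (q*u*b\<^sup>2/(d*e*f)) * -f" using nz q_nz by simp
    show ?thesis unfolding 1 2 unfolding 3 by (simp only: power_mult_distrib mult_ac)
  qed
  have r: "P (q*b'/c') n * (T n * (-(q*b/(e*f)))^n) = P (q*b/(e*f)) n"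
    "P (q*b'/d') n * (T n * (-(q*b/(d*f)))^n) = P (q*b/(d*f)) n"
    "P (q*b'/e') n * (T n * (-(q*b/(d*e)))^n) = P (q*b/(d*e)) n"
    "P (q*b'/f') n * (T n * (-(c))^n) = P (c) n"
    "P (q*b') n * (T n * (-(q*b\<^sup>2/(d*e*f)*u))^n) = P (q*b\<^sup>2/(d*e*f)*u) n"
  proof -
    show "P (q*b'/c') n * (T n * (-(q*b/(e*f)))^n) = P (q*b/(e*f)) n"
      by (rule reflect) (use nz q_nz in \<open>simp_all add: defs power2_eq_square mult_ac\<close>)
    show "P (q*b'/d') n * (T n * (-(q*b/(d*f)))^n) = P (q*b/(d*f)) n"
      by (rule reflect) (use nz q_nz in \<open>simp_all add: defs power2_eq_square mult_ac\<close>)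
    show "P (q*b'/e') n * (T n * (-(q*b/(d*e)))^n) = P (q*b/(d*e)) n"
      by (rule reflect) (use nz q_nz in \<open>simp_all add: defs power2_eq_square mult_ac\<close>)
    show "P (q*b'/f') n * (T n * (-(c))^n) = P (c) n"
      by (rule reflect) (use nz q_nz in \<open>simp_all add: defs power2_eq_square mult_ac\<close>)
    show "P (q*b') n * (T n * (-(q*b\<^sup>2/(d*e*f)*u))^n) = P (q*b\<^sup>2/(d*e*f)*u) n"
      by (rule reflect) (use nz q_nz in \<open>simp_all add: defs power2_eq_square mult_ac\<close>)
  qed
  have w: "W87 b' n c' d' e' f' q z * (P (q*b'/c') n * P (q*b'/d') n * P (q*b'/e') n * P (q*b'/f') n)
      = P (q*b') n * Om n b' c' d' e' f'"
    using watson[OF nz' ok'] unfolding z' .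
  have m: "(T n * s^n) * ((T n*(-(q*b/(e*f)))^n) * (T n*(-(q*b/(d*f)))^n) * (T n*(-(q*b/(d*e)))^n)
      * (T n*(-c)^n))
      = T n * (-(q*b\<^sup>2/(d*e*f)*u) * (q*u*b\<^sup>2/(d*e*f)))^n"
    by (rule T_power_product5) (use nz q_nz in \<open>simp add: s power2_eq_square mult_ac\<close>)
  have main: "(T n * s^n) * W87 b' n c' d' e' f' q z * (P (q*b/(e*f)) n * P (q*b/(d*f)) n
      * P (q*b/(d*e)) n * P (c) n) = P (q*b\<^sup>2/(d*e*f)*u) n * Om n b c d e f"
    by (rule renormalise[OF w r _ Om]) (subst m, simp only: power_mult_distrib mult_ac)
  have P2: "P (q*b\<^sup>2/(d*e*f)) (2*n) = P (q*b\<^sup>2/(d*e*f)) n * P (q*b\<^sup>2/(d*e*f)*u) n"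
      unfolding mult_2 qpoch_add by (simp add: mult_ac)
  have nzs: "P (q*b/c) n \<noteq> 0" "P (q*b/d) n \<noteq> 0" "P (q*b/e) n \<noteq> 0" "P (q*b/f) n \<noteq> 0"
      "P (q*b\<^sup>2/(d*e*f)) n \<noteq> 0" "P (q*b\<^sup>2/(d*e*f)*u) n \<noteq> 0"
    using assms W87_okD[OF ok] unfolding P2 qpochs_def by auto
  have "W = P (q*b) n * (P (q*b\<^sup>2/(d*e*f)*u) n * Om n b c d e f) / (P (q*b\<^sup>2/(d*e*f)*u) n * (P (q*b/c) n
      * P (q*b/d) n * P (q*b/e) n * P (q*b/f) n))"
    using W_Om nzs by (simp add: nonzero_eq_divide_eq mult_ac)
  then show ?thesis unfolding main[unfolded defs z s, symmetric] P2 qpochs_def powi_simps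
    using nzs by (simp add: mult_ac)
qed

text \<open>
  The remaining four expressions are Watson's transformation itself, followed by
  \<open>Om_pair_sears\<close>, \<open>Om_single_reversed\<close> and \<open>Om_single\<close> respectively.
\<close>
lemma W87_phi43_pair:
  assumes "qpochs [q * b / c, q * b / d] q n \<noteq> 0 \<and>
     phi43_ok n (q powi (- int n) * c * d / b) (q * b / e) (q * b / f) q"
  shows "W = qpochs [q * b / (c * d), q * b] q n / qpochs [q * b / c, q * b / d] q n
         * phi43 n (q * b / (e * f)) c d
             (q powi (- int n) * c * d / b) (q * b / e) (q * b / f) q q"
proof -
  have "phi43_ok n (1/u*c*d/b) (q*b/e) (q*b/f) q" using assms unfolding powi_simps by simp
  note phi = phi43_times_denominators[OF this]
  have r: "P (1/u*c*d/b) n * (T n*(-(q*b/(c*d)))^n) = P (q*b/(c*d)) n"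
    by (rule reflect) (use nz q_nz in simp_all)
  have a: "1/u*c*d/b = c*d/(u*b)" by simp
  have Om: "Om n b c d e f = P (q*b/(c*d)) n * P (q*b/e) n * P (q*b/f) n
      * phi43 n (q*b/(e*f)) c d (1/u*c*d/b) (q*b/e) (q*b/f) q q"
    unfolding r[symmetric] Om_def a[symmetric] phi(1)[symmetric] by (simp only: mult_ac)
  have nzs: "P (q*b/c) n \<noteq> 0" "P (q*b/d) n \<noteq> 0" "P (q*b/e) n \<noteq> 0" "P (q*b/f) n \<noteq> 0"
    using assms W87_okD[OF ok] unfolding qpochs_def by auto
  have "W = P (q*b) n * Om n b c d e f / (P (q*b/c) n * P (q*b/d) n * P (q*b/e) n * P (q*b/f) n)"
    using W_Om nzs by (simp add: nonzero_eq_divide_eq mult_ac)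
  then show ?thesis unfolding Om qpochs_def powi_simps using nzs by (simp add: mult_ac)
qed

lemma W87_phi43_pair_sears:
  assumes "qpochs [q * b / c, q * b / d, q * b / e, q * b / f] q n \<noteq> 0 \<and>
     phi43_ok n (q powi (- int n) * c * d / b) (q powi (1 - int n) / e)
       (q powi (1 - int n) / f) q"
  shows "W = (q * b / (e * f)) ^ n
         * (qpochs [q * b / (c * d), q * b, e, f] q n
            / qpochs [q * b / c, q * b / d, q * b / e, q * b / f] q n)
         * phi43 n (q powi (- int n) * c / b) (q powi (- int n) * d / b) (q * b / (e * f))
             (q powi (- int n) * c * d / b) (q powi (1 - int n) / e) (q powi (1 - int n) / f) q q"
proof -
  have "phi43_ok n (1/u*c*d/b) (q/u/e) (q/u/f) q" using assms unfolding powi_simps by simp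
  note phi = phi43_times_denominators[OF this]
  have r: "P (1/u*c*d/b) n * (T n*(-(q*b/(c*d)))^n) = P (q*b/(c*d)) n"
      "P (q/u/e) n * (T n*(-e)^n) = P e n" "P (q/u/f) n * (T n*(-f)^n) = P f n"
    by (rule reflect; use nz q_nz in simp)+
  have a: "c/(u*b) = 1/u*c/b" "d/(u*b) = 1/u*d/b" "c*d/(u*b) = 1/u*c*d/b" "q/(u*e) = q/u/e"
      "q/(u*f) = q/u/f" by simp_all
  have m: "(T n*(-(q*b/(c*d)))^n) * (T n*(-e)^n) * (T n*(-f)^n) * (q*b/(e*f))^n
      = T n * (-(q*u*b\<^sup>2/(c*d)))^n"
  proof -
    have "(T n*(-(q*b/(c*d)))^n) * (T n*(-e)^n) * (T n*(-f)^n) = T n * (-(u*b*e*f/(c*d)))^n"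
      by (rule T_power_product3) (use nz q_nz in simp)
    moreover have "-(u*b*e*f/(c*d)) * (q*b/(e*f)) = -(q*u*b\<^sup>2/(c*d))" using nz
        by (simp add: power2_eq_square mult_ac)
    ultimately show ?thesis by (simp only: mult.assoc power_mult_distrib[symmetric])
  qed
  have Om: "Om n b c d e f = (q*b/(e*f))^n * (P (q*b/(c*d)) n * P e n * P f n)
      * phi43 n (1/u*c/b) (1/u*d/b) (q*b/(e*f)) (1/u*c*d/b) (q/u/e) (q/u/f) q q"
    unfolding r[symmetric] Om_pair_sears a m[symmetric] phi(1)[symmetric] by (simp only: mult_ac)
  have nzs: "P (q*b/c) n \<noteq> 0" "P (q*b/d) n \<noteq> 0" "P (q*b/e) n \<noteq> 0" "P (q*b/f) n \<noteq> 0"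
    using assms W87_okD[OF ok] unfolding qpochs_def by auto
  have "W = P (q*b) n * Om n b c d e f / (P (q*b/c) n * P (q*b/d) n * P (q*b/e) n * P (q*b/f) n)"
    using W_Om nzs by (simp add: nonzero_eq_divide_eq mult_ac)
  then show ?thesis unfolding Om qpochs_def powi_simps using nzs by (simp add: mult_ac)
qed

lemma W87_phi43_single_reversed:
  assumes "qpochs [q * b / d, q * b / e, q * b / f] q n \<noteq> 0 \<and>
     phi43_ok n (q\<^sup>2 * b\<^sup>2 / (c * d * e * f)) (q powi (1 - int n) / c) (q * b / c) q"
  shows "W = qpochs [q\<^sup>2 * b\<^sup>2 / (c * d * e * f), q * b, c] q n
         / qpochs [q * b / d, q * b / e, q * b / f] q n
         * phi43 n (q * b / (c * d)) (q * b / (c * e)) (q * b / (c * f))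
             (q\<^sup>2 * b\<^sup>2 / (c * d * e * f)) (q powi (1 - int n) / c) (q * b / c) q q"
proof -
  have "phi43_ok n (q\<^sup>2*b\<^sup>2/(c*d*e*f)) (q/u/c) (q*b/c) q" using assms unfolding powi_simps by simp
  note phi = phi43_times_denominators[OF this]
  have r: "P (q/u/c) n * (T n*(-c)^n) = P c n" by (rule reflect) (use nz q_nz in simp_all)
  have a: "q/(u*c) = q/u/c" by simp
  have Om: "Om n b c d e f = P (q\<^sup>2*b\<^sup>2/(c*d*e*f)) n * P c n * P (q*b/c) n
      * phi43 n (q*b/(c*d)) (q*b/(c*e)) (q*b/(c*f)) (q\<^sup>2*b\<^sup>2/(c*d*e*f)) (q/u/c) (q*b/c) q q"
    unfolding r[symmetric] Om_single_reversed a phi(1)[symmetric] by (simp only: mult_ac)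
  have nzs: "P (q*b/c) n \<noteq> 0" "P (q*b/d) n \<noteq> 0" "P (q*b/e) n \<noteq> 0" "P (q*b/f) n \<noteq> 0"
    using assms W87_okD[OF ok] unfolding qpochs_def by auto
  have "W = P (q*b) n * Om n b c d e f / (P (q*b/c) n * P (q*b/d) n * P (q*b/e) n * P (q*b/f) n)"
    using W_Om nzs by (simp add: nonzero_eq_divide_eq mult_ac)
  then show ?thesis unfolding Om qpochs_def powi_simps using nzs by (simp add: mult_ac)
qed

lemma W87_phi43_single:
  assumes "qpochs [q * b / c, q * b / d, q * b / e, q * b / f] q n \<noteq> 0 \<and>
     phi43_ok n (q powi (- int n) * c * d / b) (q powi (- int n) * c * e / b)
       (q powi (- int n) * c * f / b) q"
  shows "W = c ^ n
         * (qpochs [q * b / (c * d), q * b / (c * e), q * b / (c * f), q * b] q n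
            / qpochs [q * b / c, q * b / d, q * b / e, q * b / f] q n)
         * phi43 n (q powi (- int n - 1) * c * d * e * f / b\<^sup>2) (q powi (- int n) * c / b) c
             (q powi (- int n) * c * d / b) (q powi (- int n) * c * e / b)
             (q powi (- int n) * c * f / b) q q"
proof -
  have "phi43_ok n (1/u*c*d/b) (1/u*c*e/b) (1/u*c*f/b) q" using assms unfolding powi_simps by simp
  note phi = phi43_times_denominators[OF this]
  have r: "P (1/u*c*d/b) n * (T n*(-(q*b/(c*d)))^n) = P (q*b/(c*d)) n"
      "P (1/u*c*e/b) n * (T n*(-(q*b/(c*e)))^n) = P (q*b/(c*e)) n"
    "P (1/u*c*f/b) n * (T n*(-(q*b/(c*f)))^n) = P (q*b/(c*f)) n"
    by (rule reflect; use nz q_nz in simp)+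
  have a: "c/(u*b) = 1/u*c/b" "c*d/(u*b) = 1/u*c*d/b" "c*e/(u*b) = 1/u*c*e/b" "c*f/(u*b) = 1/u*c*f/b"
    "c*d*e*f/(u*q*b\<^sup>2) = 1/(u*q)*c*d*e*f/b\<^sup>2" by simp_all
  have m: "(T n*(-(q*b/(c*d)))^n) * (T n*(-(q*b/(c*e)))^n) * (T n*(-(q*b/(c*f)))^n) * c^n
      = T n * (-(q^2*u*b^3/(c^2*d*e*f)))^n"
  proof -
    have "(T n*(-(q*b/(c*d)))^n) * (T n*(-(q*b/(c*e)))^n) * (T n*(-(q*b/(c*f)))^n)
        = T n * (-(q^2*u*b^3/(c^3*d*e*f)))^n"
      by (rule T_power_product3) (use nz q_nz in \<open>simp add: power2_eq_square power3_eq_cube mult_ac\<close>)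
    moreover have "-(q^2*u*b^3/(c^3*d*e*f)) * c = -(q^2*u*b^3/(c^2*d*e*f))" using nz
        by (simp add: power2_eq_square power3_eq_cube mult_ac)
    ultimately show ?thesis by (simp only: mult.assoc power_mult_distrib[symmetric])
  qed
  have Om: "Om n b c d e f = c^n * (P (q*b/(c*d)) n * P (q*b/(c*e)) n * P (q*b/(c*f)) n)
      * phi43 n (1/(u*q)*c*d*e*f/b\<^sup>2) (1/u*c/b) c (1/u*c*d/b) (1/u*c*e/b) (1/u*c*f/b) q q"
    unfolding r[symmetric] Om_single a m[symmetric] phi(1)[symmetric] by (simp only: mult_ac)
  have nzs: "P (q*b/c) n \<noteq> 0" "P (q*b/d) n \<noteq> 0" "P (q*b/e) n \<noteq> 0" "P (q*b/f) n \<noteq> 0"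
    using assms W87_okD[OF ok] unfolding qpochs_def by auto
  have "W = P (q*b) n * Om n b c d e f / (P (q*b/c) n * P (q*b/d) n * P (q*b/e) n * P (q*b/f) n)"
    using W_Om nzs by (simp add: nonzero_eq_divide_eq mult_ac)
  then show ?thesis unfolding Om qpochs_def powi_simps using nzs by (simp add: mult_ac)
qed

end

theorem corollary3p3:
  fixes n :: nat and b c d e f q :: complex
  assumes nz: "b \<noteq> 0" "c \<noteq> 0" "d \<noteq> 0" "e \<noteq> 0" "f \<noteq> 0" "q \<noteq> 0"
    and q: "cmod q \<noteq> 1"
    and ok: "W87_ok b n c d e f q"
  shows "let W = W87 b n c d e f q (q ^ (n + 2) * b\<^sup>2 / (c * d * e * f)) in
    (qpoch b q (2 * n) * qpochs [q * b / c, q * b / d, q * b / e, q * b / f] q n \<noteq> 0 \<and>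
     W87_ok (q powi (- 2 * int n) / b) n (q powi (- int n) * c / b) (q powi (- int n) * d / b)
       (q powi (- int n) * e / b) (q powi (- int n) * f / b) q \<longrightarrow>
     W = q ^ (n choose 2) * (- (q\<^sup>2) * b\<^sup>2 / (c * d * e * f)) ^ n
         * (qpochs [q * b, b, c, d, e, f] q n
            / (qpoch b q (2 * n) * qpochs [q * b / c, q * b / d, q * b / e, q * b / f] q n))
         * W87 (q powi (- 2 * int n) / b) n (q powi (- int n) * c / b) (q powi (- int n) * d / b)
             (q powi (- int n) * e / b) (q powi (- int n) * f / b) q
             (q ^ (n + 2) * b\<^sup>2 / (c * d * e * f)))
  \<and> (qpochs [q * b / c, q * b / e, q * b / f, d / c] q n \<noteq> 0 \<and>
     W87_ok (q powi (- int n) * c / d) n (q powi (- int n) * c / b) (q * b / (d * e))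
       (q * b / (d * f)) c q \<longrightarrow>
     W = qpochs [q * b / (c * e), q * b / (c * f), q * b, d] q n
         / qpochs [q * b / c, q * b / e, q * b / f, d / c] q n
         * W87 (q powi (- int n) * c / d) n (q powi (- int n) * c / b) (q * b / (d * e))
             (q * b / (d * f)) c q (e * f / b))
  \<and> (qpochs [q * b / (d * e * f), q * b / d, q * b / e, q * b / f] q n \<noteq> 0 \<and>
     W87_ok (q powi (- int n - 1) * d * e * f / b) n d e f
       (q powi (- int n - 1) * c * d * e * f / b\<^sup>2) q \<longrightarrow>
     W = qpochs [q * b / (d * e), q * b / (d * f), q * b / (e * f), q * b] q n
         / qpochs [q * b / (d * e * f), q * b / d, q * b / e, q * b / f] q n
         * W87 (q powi (- int n - 1) * d * e * f / b) n d e f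
             (q powi (- int n - 1) * c * d * e * f / b\<^sup>2) q (q / c))
  \<and> (qpochs [d * e * f / (q * b), q * b / c, q * b / d, q * b / e, q * b / f] q n \<noteq> 0 \<and>
     W87_ok (q powi (1 - int n) * b / (d * e * f)) n (q powi (- int n) * c / b)
       (q * b / (d * e)) (q * b / (d * f)) (q * b / (e * f)) q \<longrightarrow>
     W = qpochs [q\<^sup>2 * b\<^sup>2 / (c * d * e * f), q * b, d, e, f] q n
         / qpochs [d * e * f / (q * b), q * b / c, q * b / d, q * b / e, q * b / f] q n
         * W87 (q powi (1 - int n) * b / (d * e * f)) n (q powi (- int n) * c / b)
             (q * b / (d * e)) (q * b / (d * f)) (q * b / (e * f)) q (q / c))
  \<and> (qpochs [q * b / c, q\<^sup>2 * b\<^sup>2 / (d * e * f)] q n \<noteq> 0 \<and>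
     W87_ok (q * b\<^sup>2 / (d * e * f)) n (q * b / (d * e)) (q * b / (d * f)) (q * b / (e * f)) c q \<longrightarrow>
     W = qpochs [q\<^sup>2 * b\<^sup>2 / (c * d * e * f), q * b] q n
         / qpochs [q * b / c, q\<^sup>2 * b\<^sup>2 / (d * e * f)] q n
         * W87 (q * b\<^sup>2 / (d * e * f)) n (q * b / (d * e)) (q * b / (d * f)) (q * b / (e * f)) c q
             (q ^ (n + 1) * b / c))
  \<and> (qpoch (q * b\<^sup>2 / (d * e * f)) q (2 * n)
       * qpochs [q * b / c, q * b / d, q * b / e, q * b / f] q n \<noteq> 0 \<and>
     W87_ok (q powi (- 2 * int n - 1) * d * e * f / b\<^sup>2) n (q powi (- int n) * d / b)
       (q powi (- int n) * e / b) (q powi (- int n) * f / b)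
       (q powi (- int n - 1) * c * d * e * f / b\<^sup>2) q \<longrightarrow>
     W = q ^ (n choose 2) * (- (q * b / c)) ^ n
         * (qpochs [q * b\<^sup>2 / (d * e * f), q * b / (e * f), q * b / (d * e), q * b / (d * f),
              q * b, c] q n
            / (qpoch (q * b\<^sup>2 / (d * e * f)) q (2 * n)
               * qpochs [q * b / c, q * b / d, q * b / e, q * b / f] q n))
         * W87 (q powi (- 2 * int n - 1) * d * e * f / b\<^sup>2) n (q powi (- int n) * d / b)
             (q powi (- int n) * e / b) (q powi (- int n) * f / b)
             (q powi (- int n - 1) * c * d * e * f / b\<^sup>2) q (q ^ (n + 1) * b / c))
  \<and> (qpochs [q * b / c, q * b / d] q n \<noteq> 0 \<and>
     phi43_ok n (q powi (- int n) * c * d / b) (q * b / e) (q * b / f) q \<longrightarrow>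
     W = qpochs [q * b / (c * d), q * b] q n / qpochs [q * b / c, q * b / d] q n
         * phi43 n (q * b / (e * f)) c d
             (q powi (- int n) * c * d / b) (q * b / e) (q * b / f) q q)
  \<and> (qpochs [q * b / c, q * b / d, q * b / e, q * b / f] q n \<noteq> 0 \<and>
     phi43_ok n (q powi (- int n) * c * d / b) (q powi (1 - int n) / e)
       (q powi (1 - int n) / f) q \<longrightarrow>
     W = (q * b / (e * f)) ^ n
         * (qpochs [q * b / (c * d), q * b, e, f] q n
            / qpochs [q * b / c, q * b / d, q * b / e, q * b / f] q n)
         * phi43 n (q powi (- int n) * c / b) (q powi (- int n) * d / b) (q * b / (e * f))
             (q powi (- int n) * c * d / b) (q powi (1 - int n) / e) (q powi (1 - int n) / f) q q)
  \<and> (qpochs [q * b / d, q * b / e, q * b / f] q n \<noteq> 0 \<and>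
     phi43_ok n (q\<^sup>2 * b\<^sup>2 / (c * d * e * f)) (q powi (1 - int n) / c) (q * b / c) q \<longrightarrow>
     W = qpochs [q\<^sup>2 * b\<^sup>2 / (c * d * e * f), q * b, c] q n
         / qpochs [q * b / d, q * b / e, q * b / f] q n
         * phi43 n (q * b / (c * d)) (q * b / (c * e)) (q * b / (c * f))
             (q\<^sup>2 * b\<^sup>2 / (c * d * e * f)) (q powi (1 - int n) / c) (q * b / c) q q)
  \<and> (qpochs [q * b / c, q * b / d, q * b / e, q * b / f] q n \<noteq> 0 \<and>
     phi43_ok n (q powi (- int n) * c * d / b) (q powi (- int n) * c * e / b)
       (q powi (- int n) * c * f / b) q \<longrightarrow>
     W = c ^ n
         * (qpochs [q * b / (c * d), q * b / (c * e), q * b / (c * f), q * b] q n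
            / qpochs [q * b / c, q * b / d, q * b / e, q * b / f] q n)
         * phi43 n (q powi (- int n - 1) * c * d * e * f / b\<^sup>2) (q powi (- int n) * c / b) c
             (q powi (- int n) * c * d / b) (q powi (- int n) * c * e / b)
             (q powi (- int n) * c * f / b) q q)"
proof -
  have "q ^ k \<noteq> 1" if "0 < k" for k
  proof
    assume "q ^ k = 1"
    then have "cmod q ^ k = 1" by (metis norm_one norm_power)
    then have "cmod q = 1" using that power_eq_imp_eq_base[of "cmod q" k 1] by simp
    with q show False ..
  qed
  then interpret very_well_poised q n b c d e f
    using nz ok by unfold_locales auto
  show ?thesis
    unfolding Let_def
    by (rule conjI[OF impI[OF W87_reversed]] conjI[OF impI[OF W87_base_c_over_d]] conjI[OF impI[OF W87_base_def_over_b]]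
        conjI[OF impI[OF W87_base_b_over_def]] conjI[OF impI[OF W87_base_b2_over_def]] conjI[OF impI[OF W87_base_def_over_b2]]
        conjI[OF impI[OF W87_phi43_pair]] conjI[OF impI[OF W87_phi43_pair_sears]] conjI[OF impI[OF W87_phi43_single_reversed]]
        impI[OF W87_phi43_single] | assumption)+
qed

end
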